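(* Let $K$ be one of $\mathbb{Q},\mathbb{R},\mathbb{C}$. Let the two functions $f$ and $g$ be simple (over $K$) of order $n$ and $m$, respectively, and let $r\in K(x)$ be a rational function. Then: (a) $\int f(x)\,dx$ (any antiderivative of $f$) is simple of order $\le n+1$; (b) $f'$ is simple of order $\le n$; (c) $f+g$ is simple of order $\le n+m$; (d) $f\cdot g$ is simple of order $\le n\,m$; (e) $f\circ r$ is simple of order $\le n$; (f) for all $p\in\mathbb{Z}$ and all positive integers $q$, the function $f\circ x^{p/q}$, i.e. $x\mapsto f(x^{p/q})$, is simple of order $\le n\,q$.
   Context: A homogeneous linear ordinary differential equation $\sum_{k=0}^{N}p_k(x)\,y^{(k)}(x)=0$ whose coefficients $p_k$ are polynomials in $x$ over $K$, with $p_N\not\equiv 0$, is called a simple differential equation of order $N$ (over $K$). A function satisfying some simple differential equation is called simple; its order is the least order of a simple differential equation that it satisfies. Functions are understood to be infinitely differentiable on an open interval of the real line ($f$ and $g$ on a common interval $I$); the composite $f\circ r$ is considered on the open set of real $x$ that are not poles of $r$ and satisfy $r(x)\in I$, and $f\circ x^{p/q}$ on the set of $x>0$ with $x^{p/q}\in I$. *)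

theory Defs
  imports "HOL-Analysis.Analysis" "HOL-Computational_Algebra.Polynomial"
begin

text \<open>
  Functions on an open set of reals are modelled as total functions \<open>real \<Rightarrow> complex\<close>, of which only
  the values on that set matter. Real-valued functions are included as those with values in \<open>\<real>\<close>.
  The field of constants is a set \<open>K\<close> of complex numbers, namely \<open>\<rat>\<close>, \<open>\<real>\<close> or \<open>UNIV\<close>.
\<close>

definition poly_over :: "complex set \<Rightarrow> complex poly set" where
  "poly_over K = {p. \<forall>i. coeff p i \<in> K}"

definition nderiv :: "nat \<Rightarrow> (real \<Rightarrow> complex) \<Rightarrow> real \<Rightarrow> complex" where
  "nderiv k f = ((\<lambda>h x. vector_derivative h (at x)) ^^ k) f"

definition smooth_on :: "real set \<Rightarrow> (real \<Rightarrow> complex) \<Rightarrow> bool" where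
  "smooth_on S f \<longleftrightarrow> (\<forall>k. \<forall>x\<in>S. nderiv k f differentiable at x)"

definition satisfies_simple_ode :: "complex set \<Rightarrow> real set \<Rightarrow> nat \<Rightarrow> (real \<Rightarrow> complex) \<Rightarrow> bool" where
  "satisfies_simple_ode K S N y \<longleftrightarrow>
    (\<exists>p :: nat \<Rightarrow> complex poly. (\<forall>k\<le>N. p k \<in> poly_over K) \<and> p N \<noteq> 0 \<and>
      (\<forall>x\<in>S. (\<Sum>k\<le>N. poly (p k) (of_real x) * nderiv k y x) = 0))"

text \<open>The following notions are meant for open \<open>S\<close> only.\<close>

definition simple_on :: "complex set \<Rightarrow> real set \<Rightarrow> (real \<Rightarrow> complex) \<Rightarrow> bool" where
  "simple_on K S f \<longleftrightarrow> smooth_on S f \<and> (\<exists>N. satisfies_simple_ode K S N f)"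

definition simple_order :: "complex set \<Rightarrow> real set \<Rightarrow> (real \<Rightarrow> complex) \<Rightarrow> nat" where
  "simple_order K S f = (LEAST N. satisfies_simple_ode K S N f)"

text \<open>
  A rational function is given as a quotient \<open>a / b\<close> in lowest terms, so that its poles are exactly
  the zeros of \<open>b\<close>. If it takes real values at real arguments (in particular if its coefficients
  are real), the set of non-poles mapped into the open set \<open>I\<close> is open, and \<open>rat_dom\<close> is this set.
  If it has non-real coefficients, the set may contain isolated points, around which the composite
  is not defined; the interior discards them.
\<close>

definition rat_fun :: "complex poly \<Rightarrow> complex poly \<Rightarrow> real \<Rightarrow> complex" where
  "rat_fun a b x = poly a (of_real x) / poly b (of_real x)"

definition rat_dom :: "complex poly \<Rightarrow> complex poly \<Rightarrow> real set \<Rightarrow> real set" where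
  "rat_dom a b I = interior {x. poly b (of_real x) \<noteq> 0 \<and> rat_fun a b x \<in> of_real ` I}"

lemma rat_dom_real:
  assumes "open I" and real: "\<And>x. poly b (of_real x) \<noteq> 0 \<Longrightarrow> rat_fun a b x \<in> \<real>"
  shows "rat_dom a b I = {x. poly b (of_real x) \<noteq> 0 \<and> rat_fun a b x \<in> of_real ` I}"
proof -
  let ?U = "{x :: real. poly b (of_real x) \<noteq> 0}"
  have eq: "{x. poly b (of_real x) \<noteq> 0 \<and> rat_fun a b x \<in> of_real ` I}
      = ?U \<inter> (\<lambda>x. Re (rat_fun a b x)) -` I"
    using real by (force simp: Reals_def)
  have "open ?U"
    by (intro open_Collect_neq continuous_intros)
  moreover have "continuous_on ?U (\<lambda>x. Re (rat_fun a b x))"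
    unfolding rat_fun_def by (intro continuous_intros) auto
  ultimately have "open (?U \<inter> (\<lambda>x. Re (rat_fun a b x)) -` I)"
    using \<open>open I\<close> by (intro continuous_open_preimage)
  then show ?thesis
    unfolding rat_dom_def eq by (rule interior_open)
qed

end

theory Submission
  imports Defs
begin

text \<open>
  A function satisfies a simple equation of order at most \<open>d\<close> as soon as all its derivatives lie in
  one space spanned over \<open>K(x)\<close> by \<open>d\<close> functions: \<open>d + 1\<close> derivatives are then linearly dependent, and
  clearing denominators in the dependence gives the equation. Such a space contains all derivatives
  of its smooth members if it contains the derivatives of its generators
  (\<open>simple_of_rat_span\<close>). So every part of the theorem, except for antiderivatives,
  amounts to naming generators. If \<open>f\<close> and \<open>g\<close> satisfy equations of order \<open>n\<close> and \<open>m\<close>, they are: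

  \<^item> for \<open>f'\<close>: the derivatives of \<open>f\<close> of order below \<open>n\<close>;

  \<^item> for \<open>f + g\<close>: those of \<open>f\<close> below \<open>n\<close> together with those of \<open>g\<close> below \<open>m\<close>;

  \<^item> for \<open>f g\<close>: the \<open>n m\<close> products of these;

  \<^item> for \<open>f \<circ> r\<close> with \<open>r\<close> not constant: the functions \<open>f\<^sup>(\<^sup>k\<^sup>) \<circ> r\<close> with \<open>k < n\<close>, since the leading
    coefficient of the equation of \<open>f\<close> stays nonzero when \<open>r\<close> is substituted;

  \<^item> for \<open>h(x\<^sup>1\<^sup>/\<^sup>q)\<close>: the \<open>n q\<close> functions \<open>x\<^sup>i\<^sup>/\<^sup>q h\<^sup>(\<^sup>k\<^sup>)(x\<^sup>1\<^sup>/\<^sup>q)\<close> with \<open>i < q\<close> and \<open>k < n\<close>. Here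
    the leading coefficient becomes a polynomial in \<open>x\<^sup>1\<^sup>/\<^sup>q\<close>; it can be inverted because some multiple of
    it is a polynomial in \<open>x\<close> (\<open>exists_multiple_in_power\<close>).

  An equation for an antiderivative is that of \<open>f\<close> with the indices of the derivatives shifted by one.
  The exponent \<open>p / q\<close> is reached by first substituting the rational function \<open>t\<^sup>p\<close> and then
  \<open>t = x\<^sup>1\<^sup>/\<^sup>q\<close>.

  The linear algebra is done with polynomial coefficients, without a field of fractions: membership
  in a span over \<open>K(x)\<close> carries its common denominator along. This is why the lemmas can take \<open>K\<close> to be
  any subring of the complex numbers.
\<close>

section \<open>Smooth functions on an open set\<close>

lemma nderiv_0 [simp]: "nderiv 0 f = f"
  by (simp add: nderiv_def)

lemma nderiv_Suc: "nderiv (Suc k) f = (\<lambda>x. vector_derivative (nderiv k f) (at x))"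
  by (simp add: nderiv_def)

lemma nderiv_vector_derivative: "nderiv k (\<lambda>x. vector_derivative f (at x)) = nderiv (Suc k) f"
  by (simp add: nderiv_def funpow_swap1 del: funpow.simps(2)) (simp add: funpow_Suc_right del: funpow.simps(2))

lemma nderiv_cong_open:
  assumes "open S" and "\<And>x. x \<in> S \<Longrightarrow> f x = g x" and "x \<in> S"
  shows "nderiv k f x = nderiv k g x"
  using assms(3)
proof (induction k arbitrary: x)
  case (Suc k)
  have "eventually (\<lambda>z. z \<in> S) (nhds x)"
    using assms(1) Suc.prems by (rule eventually_nhds_in_open)
  then have "eventually (\<lambda>z. z \<in> UNIV \<longrightarrow> nderiv k f z = nderiv k g z) (nhds x)"
    by (rule eventually_mono) (simp add: Suc.IH)
  then show ?case
    unfolding nderiv_Suc by (intro vector_derivative_cong_eq) auto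
qed (use assms in auto)

lemma smooth_on_deriv:
  assumes "smooth_on S f" "x \<in> S"
  shows "(nderiv k f has_vector_derivative nderiv (Suc k) f x) (at x)"
  using assms unfolding smooth_on_def nderiv_Suc by (simp add: vector_derivative_works)

text \<open>
  Closure of smoothness under products and substitutions is an induction on the number of
  derivatives, in which the derivative is again a product or a composite. The following predicate
  peels off the first derivative and names it by any function that agrees with it on \<open>S\<close>; iterating
  \<^const>\<open>nderiv\<close> instead would require formulas for the higher derivatives.
\<close>
fun times_diff :: "nat \<Rightarrow> real set \<Rightarrow> (real \<Rightarrow> complex) \<Rightarrow> bool" where
  "times_diff 0 S f = True"
| "times_diff (Suc k) S f =
     (\<exists>f'. (\<forall>x\<in>S. (f has_vector_derivative f' x) (at x)) \<and> times_diff k S f')"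

lemma times_diff_SucE:
  assumes "times_diff (Suc k) S f"
  obtains f' where "\<And>x. x \<in> S \<Longrightarrow> (f has_vector_derivative f' x) (at x)" "times_diff k S f'"
  using assms by auto

lemma times_diff_SucI:
  assumes "\<And>x. x \<in> S \<Longrightarrow> (f has_vector_derivative f' x) (at x)" "times_diff k S f'"
  shows "times_diff (Suc k) S f"
  using assms by auto

declare times_diff.simps(2) [simp del]

lemma times_diff_SucD: "times_diff (Suc k) S f \<Longrightarrow> times_diff k S f"
proof (induction k arbitrary: f)
  case (Suc k)
  from Suc.prems obtain f' where f':
    "\<And>x. x \<in> S \<Longrightarrow> (f has_vector_derivative f' x) (at x)" "times_diff (Suc k) S f'"
    by (rule times_diff_SucE) blast
  show ?case by (rule times_diff_SucI[OF f'(1) Suc.IH[OF f'(2)]])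
qed simp

lemma smooth_on_iff_times_diff:
  assumes "open S"
  shows "smooth_on S f \<longleftrightarrow> (\<forall>k. times_diff k S f)"
proof
  assume f: "smooth_on S f"
  have "times_diff k S (nderiv j f)" for k j
  proof (induction k arbitrary: j)
    case (Suc k)
    show ?case
      by (rule times_diff_SucI[OF smooth_on_deriv[OF f, of _ j] Suc.IH[of "Suc j"]])
  qed simp
  from this[of _ 0] show "\<forall>k. times_diff k S f" by simp
next
  assume *: "\<forall>k. times_diff k S f"
  have "nderiv k g differentiable at x" if "times_diff (Suc k) S g" "x \<in> S" for k g x
    using that
  proof (induction k arbitrary: g x)
    case 0
    from 0(1) obtain g' where "\<And>x. x \<in> S \<Longrightarrow> (g has_vector_derivative g' x) (at x)"
      by (rule times_diff_SucE) blast
    from differentiableI_vector[OF this[OF 0(2)]] show ?case by simp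
  next
    case (Suc k)
    obtain g' where g': "\<And>x. x \<in> S \<Longrightarrow> (g has_vector_derivative g' x) (at x)"
        "times_diff (Suc k) S g'"
      using Suc.prems(1) by (rule times_diff_SucE) blast
    have "g' z = vector_derivative g (at z)" if "z \<in> S" for z
      using g'(1)[OF that] by (simp add: vector_derivative_at)
    then have eq: "nderiv k g' z = nderiv (Suc k) g z" if "z \<in> S" for z
      using nderiv_cong_open[OF assms, of g' "\<lambda>x. vector_derivative g (at x)" z k] that
      by (simp add: nderiv_vector_derivative)
    have "(nderiv k g' has_vector_derivative vector_derivative (nderiv k g') (at x)) (at x)"
      using Suc.IH[OF g'(2) Suc.prems(2)] by (simp add: vector_derivative_works)
    then have "(nderiv (Suc k) g has_vector_derivative vector_derivative (nderiv k g') (at x)) (at x)"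
      using assms Suc.prems(2) eq by (rule has_vector_derivative_transform_within_open)
    then show ?case by (rule differentiableI_vector)
  qed
  then show "smooth_on S f"
    using * unfolding smooth_on_def by simp
qed

lemma times_diff_cong:
  assumes "open S" "\<And>x. x \<in> S \<Longrightarrow> f x = g x" "times_diff k S f"
  shows "times_diff k S g"
proof (cases k)
  case (Suc j)
  with assms(3) have "times_diff (Suc j) S f" by simp
  then obtain f' where f': "\<And>x. x \<in> S \<Longrightarrow> (f has_vector_derivative f' x) (at x)" "times_diff j S f'"
    by (rule times_diff_SucE) blast
  have "(g has_vector_derivative f' x) (at x)" if "x \<in> S" for x
    using f'(1)[OF that] assms(1) that assms(2) by (rule has_vector_derivative_transform_within_open)
  then show ?thesis using f'(2) unfolding Suc by (rule times_diff_SucI)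
qed simp

lemma times_diff_const: "times_diff k S (\<lambda>x. c)"
proof (induction k arbitrary: c)
  case (Suc k)
  show ?case by (rule times_diff_SucI[OF has_vector_derivative_const Suc.IH])
qed simp

lemma times_diff_add:
  "times_diff k S f \<Longrightarrow> times_diff k S g \<Longrightarrow> times_diff k S (\<lambda>x. f x + g x)"
proof (induction k arbitrary: f g)
  case (Suc k)
  obtain f' where f':
      "\<And>x. x \<in> S \<Longrightarrow> (f has_vector_derivative f' x) (at x)" "times_diff k S f'"
    using Suc.prems(1) by (rule times_diff_SucE) blast
  obtain g' where g':
      "\<And>x. x \<in> S \<Longrightarrow> (g has_vector_derivative g' x) (at x)" "times_diff k S g'"
    using Suc.prems(2) by (rule times_diff_SucE) blast
  show ?case
    by (rule times_diff_SucI[OF has_vector_derivative_add[OF f'(1) g'(1)] Suc.IH[OF f'(2) g'(2)]])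
qed simp

lemma times_diff_mult:
  "times_diff k S f \<Longrightarrow> times_diff k S g \<Longrightarrow> times_diff k S (\<lambda>x. f x * g x)"
proof (induction k arbitrary: f g)
  case (Suc k)
  obtain f' where f':
      "\<And>x. x \<in> S \<Longrightarrow> (f has_vector_derivative f' x) (at x)" "times_diff k S f'"
    using Suc.prems(1) by (rule times_diff_SucE) blast
  obtain g' where g':
      "\<And>x. x \<in> S \<Longrightarrow> (g has_vector_derivative g' x) (at x)" "times_diff k S g'"
    using Suc.prems(2) by (rule times_diff_SucE) blast
  have "times_diff k S (\<lambda>x. f x * g' x + f' x * g x)"
    by (intro times_diff_add Suc.IH f' g' Suc.prems[THEN times_diff_SucD])
  moreover have "((\<lambda>x. f x * g x) has_vector_derivative f x * g' x + f' x * g x) (at x)"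
    if "x \<in> S" for x
    using f'(1)[OF that] g'(1)[OF that] by (rule has_vector_derivative_mult)
  ultimately show ?case by (rule times_diff_SucI[rotated])
qed simp

text \<open>
  Real substitutions are treated as complex-valued functions, so that \<^const>\<open>smooth_on\<close> and rational
  functions apply to them. Their derivatives are then complex numbers, but necessarily real.
\<close>
lemma has_vector_derivative_of_real_unique:
  assumes "((\<lambda>x. complex_of_real (\<rho> x)) has_vector_derivative w) (at x)"
  shows "(\<rho> has_vector_derivative Re w) (at x)" and "w = of_real (Re w)"
proof -
  have "((\<lambda>x. Re (complex_of_real (\<rho> x))) has_vector_derivative Re w) (at x)"
    using assms by (rule bounded_linear.has_vector_derivative[OF bounded_linear_Re])
  then show *: "(\<rho> has_vector_derivative Re w) (at x)" by simp
  have "((\<lambda>x. complex_of_real (\<rho> x)) has_vector_derivative of_real (Re w)) (at x)"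
    using * by (rule bounded_linear.has_vector_derivative[OF bounded_linear_of_real])
  with assms show "w = of_real (Re w)"
    by (rule vector_derivative_unique_at)
qed

lemma has_vector_derivative_compose_real:
  assumes "((\<lambda>x. complex_of_real (\<rho> x)) has_vector_derivative w) (at x)"
    and "(f has_vector_derivative f') (at (\<rho> x))"
  shows "((\<lambda>x. f (\<rho> x)) has_vector_derivative w * f') (at x)"
proof -
  note \<rho> = has_vector_derivative_of_real_unique[OF assms(1)]
  have "((f \<circ> \<rho>) has_vector_derivative Re w *\<^sub>R f') (at x)"
    using \<rho>(1) assms(2) by (rule vector_diff_chain_at)
  then show ?thesis
    by (subst \<rho>(2)) (simp add: o_def scaleR_conv_of_real)
qed

lemma times_diff_compose:
  assumes "times_diff k T (\<lambda>x. complex_of_real (\<rho> x))" "times_diff k S f" "\<rho> ` T \<subseteq> S"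
  shows "times_diff k T (\<lambda>x. f (\<rho> x))"
  using assms(1,2)
proof (induction k arbitrary: f)
  case (Suc k)
  obtain w where w:
      "\<And>x. x \<in> T \<Longrightarrow> ((\<lambda>x. complex_of_real (\<rho> x)) has_vector_derivative w x) (at x)"
      "times_diff k T w"
    using Suc.prems(1) by (rule times_diff_SucE) blast
  obtain f' where f':
      "\<And>x. x \<in> S \<Longrightarrow> (f has_vector_derivative f' x) (at x)" "times_diff k S f'"
    using Suc.prems(2) by (rule times_diff_SucE) blast
  have \<rho>: "\<rho> x \<in> S" if "x \<in> T" for x using that assms(3) by auto
  have "times_diff k T (\<lambda>x. w x * f' (\<rho> x))"
    using w(2) Suc.IH[OF Suc.prems(1)[THEN times_diff_SucD] f'(2)] by (rule times_diff_mult)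
  moreover have "((\<lambda>x. f (\<rho> x)) has_vector_derivative w x * f' (\<rho> x)) (at x)" if "x \<in> T" for x
    using w(1)[OF that] f'(1)[OF \<rho>[OF that]] by (rule has_vector_derivative_compose_real)
  ultimately show ?case by (rule times_diff_SucI[rotated])
qed simp

lemma smooth_on_vector_derivative:
  "smooth_on S f \<Longrightarrow> smooth_on S (\<lambda>x. vector_derivative f (at x))"
  by (simp add: smooth_on_def nderiv_vector_derivative)

lemma smooth_on_subset: "smooth_on S f \<Longrightarrow> T \<subseteq> S \<Longrightarrow> smooth_on T f"
  by (auto simp: smooth_on_def)

lemma smooth_on_cong:
  "open S \<Longrightarrow> (\<And>x. x \<in> S \<Longrightarrow> f x = g x) \<Longrightarrow> smooth_on S f \<Longrightarrow> smooth_on S g"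
  by (simp add: smooth_on_iff_times_diff times_diff_cong[of S f g])

lemma smooth_on_antiderivative:
  assumes "open S" "\<And>x. x \<in> S \<Longrightarrow> (F has_vector_derivative f x) (at x)" "smooth_on S f"
  shows "smooth_on S F"
proof -
  have "times_diff k S F" for k
  proof (cases k)
    case (Suc j)
    have "times_diff j S f" using assms(1,3) by (simp add: smooth_on_iff_times_diff)
    with assms(2) show ?thesis unfolding Suc by (rule times_diff_SucI)
  qed simp
  then show ?thesis using assms(1) by (simp add: smooth_on_iff_times_diff)
qed

lemma smooth_on_add:
  "open S \<Longrightarrow> smooth_on S f \<Longrightarrow> smooth_on S g \<Longrightarrow> smooth_on S (\<lambda>x. f x + g x)"
  by (simp add: smooth_on_iff_times_diff times_diff_add)

lemma smooth_on_mult: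
  "open S \<Longrightarrow> smooth_on S f \<Longrightarrow> smooth_on S g \<Longrightarrow> smooth_on S (\<lambda>x. f x * g x)"
  by (simp add: smooth_on_iff_times_diff times_diff_mult)

lemma smooth_on_compose:
  assumes "open T" "open S" "smooth_on T (\<lambda>x. complex_of_real (\<rho> x))" "smooth_on S f" "\<rho> ` T \<subseteq> S"
  shows "smooth_on T (\<lambda>x. f (\<rho> x))"
proof -
  have "times_diff k T (\<lambda>x. f (\<rho> x))" for k
    using assms by (intro times_diff_compose[of k T \<rho> S f]) (simp_all add: smooth_on_iff_times_diff)
  then show ?thesis using assms(1) by (simp add: smooth_on_iff_times_diff)
qed

lemma has_vector_derivative_poly:
  "((\<lambda>x. poly p (of_real x)) has_vector_derivative poly (pderiv p) (of_real x :: complex)) (at x)"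
  using has_vector_derivative_real_field[OF poly_DERIV[of p "of_real x"]] by simp

lemma has_vector_derivative_rat_fun:
  assumes "poly b (of_real x) \<noteq> 0"
  shows "(rat_fun a b has_vector_derivative rat_fun (pderiv a * b - a * pderiv b) (b\<^sup>2) x) (at x)"
proof -
  have "((\<lambda>z. poly a z / poly b z) has_field_derivative
      poly (pderiv a * b - a * pderiv b) (of_real x) / poly (b\<^sup>2) (of_real x)) (at (of_real x))"
    using assms by (auto intro!: derivative_eq_intros simp: power2_eq_square)
  then show ?thesis
    unfolding rat_fun_def by (rule has_vector_derivative_real_field)
qed

lemma smooth_on_rat_fun:
  assumes "open S" "\<And>x. x \<in> S \<Longrightarrow> poly b (of_real x) \<noteq> 0"
  shows "smooth_on S (rat_fun a b)"
proof -
  have "times_diff k S (rat_fun a b)" if "\<And>x. x \<in> S \<Longrightarrow> poly b (of_real x) \<noteq> 0" for a b k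
    using that
  proof (induction k arbitrary: a b)
    case (Suc k)
    have "times_diff k S (rat_fun (pderiv a * b - a * pderiv b) (b\<^sup>2))"
      using Suc.prems by (intro Suc.IH) simp
    with has_vector_derivative_rat_fun[OF Suc.prems] show ?case by (rule times_diff_SucI)
  qed simp
  then show ?thesis using assms by (simp add: smooth_on_iff_times_diff)
qed

lemma has_vector_derivative_powr:
  assumes "x > 0"
  shows "((\<lambda>x. complex_of_real (x powr s)) has_vector_derivative of_real (s * x powr (s - 1))) (at x)"
proof -
  have "((\<lambda>x. x powr s) has_vector_derivative s * x powr (s - 1)) (at x)"
    using assms by (auto intro!: derivative_eq_intros
      simp flip: has_real_derivative_iff_has_vector_derivative)
  then show ?thesis
    by (rule bounded_linear.has_vector_derivative[OF bounded_linear_of_real])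
qed

lemma smooth_on_powr:
  assumes "open S" "S \<subseteq> {0<..}"
  shows "smooth_on S (\<lambda>x. complex_of_real (x powr s))"
proof -
  have "times_diff k S (\<lambda>x. complex_of_real (x powr s))" for k s
  proof (induction k arbitrary: s)
    case (Suc k)
    have "times_diff k S (\<lambda>x. complex_of_real (s * x powr (s - 1)))"
      using times_diff_mult[OF times_diff_const[of k S "of_real s"] Suc.IH[of "s - 1"]] by simp
    moreover have "x > 0" if "x \<in> S" for x using that assms(2) by auto
    ultimately show ?case
      using times_diff_SucI[OF has_vector_derivative_powr] by blast
  qed simp
  then show ?thesis using assms by (simp add: smooth_on_iff_times_diff)
qed

text \<open>
  Functions of order zero vanish: the equation alone allows nonzero values at the roots of its
  coefficient, and continuity excludes them.
\<close>
lemma zero_of_poly_mult_zero: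
  assumes "open S" "continuous_on S y" "p \<noteq> 0"
    and eq: "\<And>x. x \<in> S \<Longrightarrow> poly p (of_real x :: complex) * y x = 0" and "x \<in> S"
  shows "y x = 0"
proof (rule ccontr)
  assume "y x \<noteq> 0"
  let ?U = "S \<inter> y -` (- {0})"
  have "open ?U"
    using assms by (intro continuous_open_preimage) auto
  moreover have "?U \<noteq> {}"
    using \<open>y x \<noteq> 0\<close> \<open>x \<in> S\<close> by blast
  ultimately have "infinite ?U"
    using finite_imp_not_open by blast
  moreover have "complex_of_real ` ?U \<subseteq> {z. poly p z = 0}"
    using eq by auto
  then have "finite ?U"
    using poly_roots_finite[OF \<open>p \<noteq> 0\<close>] finite_subset finite_imageD
    by (metis inj_on_subset inj_of_real subset_UNIV)
  ultimately show False by simp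
qed

section \<open>Homogeneous linear systems over a subring of a domain\<close>

text \<open>
  Gaussian elimination without division: with a pivot \<open>s\<close> in row \<open>i0\<close>, every other row is multiplied by
  \<open>s\<close> before the multiple of row \<open>i0\<close> is subtracted, and a solution of the smaller system is scaled by
  \<open>s\<close> before the pivot variable is solved for. The solution thus stays in the subring \<open>R\<close>; it is used
  for polynomials with coefficients in \<open>K\<close> and for \<open>K\<close> itself.
\<close>
lemma homogeneous_system_nontrivial_solution:
  fixes A :: "'i \<Rightarrow> 'j \<Rightarrow> 'a :: idom"
  assumes R: "0 \<in> R" "1 \<in> R" "\<And>x y. x \<in> R \<Longrightarrow> y \<in> R \<Longrightarrow> x - y \<in> R" "\<And>x y. x \<in> R \<Longrightarrow> y \<in> R \<Longrightarrow> x * y \<in> R"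
    and "finite I" "finite J" "card I < card J" "\<And>i j. i \<in> I \<Longrightarrow> j \<in> J \<Longrightarrow> A i j \<in> R"
  shows "\<exists>c. (\<forall>j\<in>J. c j \<in> R) \<and> (\<exists>j\<in>J. c j \<noteq> 0) \<and> (\<forall>i\<in>I. (\<Sum>j\<in>J. A i j * c j) = 0)"
  using assms(5-8)
proof (induction I arbitrary: J A rule: finite_induct)
  case empty
  then have "J \<noteq> {}" by auto
  then show ?case using R by (intro exI[of _ "\<lambda>_. 1"]) auto
next
  case (insert i0 I)
  show ?case
  proof (cases "\<forall>j\<in>J. A i0 j = 0")
    case True
    have "\<exists>c. (\<forall>j\<in>J. c j \<in> R) \<and> (\<exists>j\<in>J. c j \<noteq> 0) \<and> (\<forall>i\<in>I. (\<Sum>j\<in>J. A i j * c j) = 0)"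
      using insert by (intro insert.IH) auto
    then show ?thesis using True by auto
  next
    case False
    then obtain j0 where j0: "j0 \<in> J" "A i0 j0 \<noteq> 0" by auto
    define J' where "J' = J - {j0}"
    define s where "s = A i0 j0"
    have J: "J = insert j0 J'" "finite J'" "j0 \<notin> J'" and card: "card I < card J'"
      using j0 insert.prems insert.hyps by (auto simp: J'_def)
    have AR: "A i j \<in> R" if "i \<in> insert i0 I" "j \<in> J" for i j using that insert.prems by auto
    have "\<exists>c. (\<forall>j\<in>J'. c j \<in> R) \<and> (\<exists>j\<in>J'. c j \<noteq> 0) \<and>
        (\<forall>i\<in>I. (\<Sum>j\<in>J'. (s * A i j - A i j0 * A i0 j) * c j) = 0)"
      using card J AR j0 by (intro insert.IH) (auto simp: s_def intro!: R)
    then obtain c where c: "\<And>j. j \<in> J' \<Longrightarrow> c j \<in> R" "\<exists>j\<in>J'. c j \<noteq> 0"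
      "\<And>i. i \<in> I \<Longrightarrow> (\<Sum>j\<in>J'. (s * A i j - A i j0 * A i0 j) * c j) = 0" by blast
    have neg: "- x \<in> R" if "x \<in> R" for x using R(3)[OF R(1) that] by simp
    have plus: "x + y \<in> R" if "x \<in> R" "y \<in> R" for x y using R(3)[OF that(1) neg[OF that(2)]] by simp
    have sum: "(\<Sum>j\<in>X. h j) \<in> R" if "finite X" "\<And>j. j \<in> X \<Longrightarrow> h j \<in> R" for X and h :: "'j \<Rightarrow> 'a"
      using that by (induction X rule: finite_induct) (auto intro: R plus)
    define t where "t = (\<Sum>j\<in>J'. A i0 j * c j)"
    define d where "d = (\<lambda>j. if j = j0 then - t else s * c j)"
    have t: "t \<in> R" unfolding t_def using J AR c by (intro sum R) auto
    have row: "(\<Sum>j\<in>J. A i j * d j) = (\<Sum>j\<in>J'. (s * A i j - A i j0 * A i0 j) * c j)" for i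
    proof -
      have "(\<Sum>j\<in>J. A i j * d j) = (\<Sum>j\<in>J'. A i j * d j) - A i j0 * t"
        using J by (simp add: d_def)
      also have "(\<Sum>j\<in>J'. A i j * d j) = (\<Sum>j\<in>J'. A i j * (s * c j))"
        using J by (intro sum.cong) (auto simp: d_def)
      finally show ?thesis
        by (simp add: t_def algebra_simps sum_subtractf sum_distrib_left)
    qed
    have "\<forall>j\<in>J. d j \<in> R"
      using t neg R AR[of i0 j0] c j0 J by (auto simp: d_def s_def)
    moreover have "\<exists>j\<in>J. d j \<noteq> 0"
      using c(2) J j0 by (auto simp: d_def s_def)
    moreover have "\<forall>i\<in>insert i0 I. (\<Sum>j\<in>J. A i j * d j) = 0"
      using c(3) by (auto simp: row s_def)
    ultimately show ?thesis by blast
  qed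
qed

section \<open>Polynomials over a ring of constants\<close>

locale constant_ring =
  fixes K :: "complex set"
  assumes zero_mem: "0 \<in> K" and one_mem: "1 \<in> K"
    and diff_mem: "x \<in> K \<Longrightarrow> y \<in> K \<Longrightarrow> x - y \<in> K"
    and mult_mem: "x \<in> K \<Longrightarrow> y \<in> K \<Longrightarrow> x * y \<in> K"
begin

lemma uminus_mem: "x \<in> K \<Longrightarrow> - x \<in> K"
  using diff_mem[OF zero_mem, of x] by simp

lemma add_mem: "x \<in> K \<Longrightarrow> y \<in> K \<Longrightarrow> x + y \<in> K"
  using diff_mem[of x "- y"] uminus_mem[of y] by simp

lemma sum_mem: "(\<And>i. i \<in> X \<Longrightarrow> h i \<in> K) \<Longrightarrow> (\<Sum>i\<in>X. h i) \<in> K"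
  by (induction X rule: infinite_finite_induct) (auto intro: zero_mem add_mem)

lemma of_nat_mem: "of_nat k \<in> K"
  by (induction k) (auto intro: zero_mem one_mem add_mem)

lemma poly_over_0: "0 \<in> poly_over K" and poly_over_1: "1 \<in> poly_over K"
  by (auto simp: poly_over_def zero_mem one_mem)

lemma poly_over_add: "p \<in> poly_over K \<Longrightarrow> q \<in> poly_over K \<Longrightarrow> p + q \<in> poly_over K"
  by (simp add: poly_over_def add_mem)

lemma poly_over_diff: "p \<in> poly_over K \<Longrightarrow> q \<in> poly_over K \<Longrightarrow> p - q \<in> poly_over K"
  by (simp add: poly_over_def diff_mem)

lemma poly_over_uminus: "p \<in> poly_over K \<Longrightarrow> - p \<in> poly_over K"
  by (simp add: poly_over_def uminus_mem)

lemma poly_over_mult: "p \<in> poly_over K \<Longrightarrow> q \<in> poly_over K \<Longrightarrow> p * q \<in> poly_over K"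
  by (simp add: poly_over_def coeff_mult sum_mem mult_mem)

lemma poly_over_smult: "c \<in> K \<Longrightarrow> p \<in> poly_over K \<Longrightarrow> smult c p \<in> poly_over K"
  by (simp add: poly_over_def mult_mem)

lemma poly_over_pderiv: "p \<in> poly_over K \<Longrightarrow> pderiv p \<in> poly_over K"
  by (simp add: poly_over_def coeff_pderiv mult_mem of_nat_mem del: of_nat_Suc)

lemma poly_over_monom: "c \<in> K \<Longrightarrow> monom c k \<in> poly_over K"
  by (simp add: poly_over_def zero_mem)

lemma poly_over_sum: "(\<And>i. i \<in> X \<Longrightarrow> h i \<in> poly_over K) \<Longrightarrow> (\<Sum>i\<in>X. h i) \<in> poly_over K"
  by (induction X rule: infinite_finite_induct) (auto intro: poly_over_0 poly_over_add)

lemma poly_over_power: "p \<in> poly_over K \<Longrightarrow> p ^ k \<in> poly_over K"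
  by (induction k) (auto intro: poly_over_1 poly_over_mult)

lemmas poly_over_intros = poly_over_0 poly_over_1 poly_over_add poly_over_diff
  poly_over_uminus poly_over_mult poly_over_smult poly_over_pderiv poly_over_monom poly_over_sum
  poly_over_power

end

lemma constant_ring_Rats: "constant_ring \<rat>"
  and constant_ring_Reals: "constant_ring \<real>"
  and constant_ring_UNIV: "constant_ring UNIV"
  by (unfold_locales; simp)+

section \<open>Rational spans of finitely many functions\<close>

text \<open>
  Membership of \<open>y\<close>, on \<open>S\<close>, in the span of the \<open>u j\<close> over \<open>K(x)\<close>. The polynomial \<open>E\<close> is a common
  denominator of the coefficients. Multiplying by it, rather than dividing, keeps the relation
  meaningful at its roots, so that no points have to be removed from \<open>S\<close>.
\<close>
definition rat_span ::
    "complex set \<Rightarrow> real set \<Rightarrow> 'j set \<Rightarrow> ('j \<Rightarrow> real \<Rightarrow> complex) \<Rightarrow> (real \<Rightarrow> complex) \<Rightarrow> bool" where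
  "rat_span K S J u y \<longleftrightarrow> (\<exists>E c. E \<in> poly_over K \<and> E \<noteq> 0 \<and> (\<forall>j\<in>J. c j \<in> poly_over K) \<and>
     (\<forall>x\<in>S. poly E (of_real x) * y x = (\<Sum>j\<in>J. poly (c j) (of_real x) * u j x)))"

lemma rat_spanI:
  assumes "E \<in> poly_over K" "E \<noteq> 0" "\<And>j. j \<in> J \<Longrightarrow> c j \<in> poly_over K"
    "\<And>x. x \<in> S \<Longrightarrow> poly E (of_real x) * y x = (\<Sum>j\<in>J. poly (c j) (of_real x) * u j x)"
  shows "rat_span K S J u y"
  using assms unfolding rat_span_def by (intro exI[of _ E] exI[of _ c]) auto

lemma rat_spanE:
  assumes "rat_span K S J u y"
  obtains E c where "E \<in> poly_over K" "E \<noteq> 0" "\<And>j. j \<in> J \<Longrightarrow> c j \<in> poly_over K"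
    "\<And>x. x \<in> S \<Longrightarrow> poly E (of_real x) * y x = (\<Sum>j\<in>J. poly (c j) (of_real x) * u j x)"
  using assms unfolding rat_span_def by blast

lemma rat_span_cong:
  assumes "rat_span K S J u y" "\<And>x. x \<in> S \<Longrightarrow> y x = z x"
  shows "rat_span K S J u z"
  using assms(1) by (rule rat_spanE) (use assms(2) in \<open>auto intro: rat_spanI\<close>)

lemma simple_order_le_iff:
  "simple_on K S y \<and> simple_order K S y \<le> d \<longleftrightarrow>
     smooth_on S y \<and> (\<exists>N\<le>d. satisfies_simple_ode K S N y)"
proof
  assume *: "simple_on K S y \<and> simple_order K S y \<le> d"
  then have "satisfies_simple_ode K S (simple_order K S y) y"
    unfolding simple_order_def simple_on_def by (metis LeastI_ex)
  with * show "smooth_on S y \<and> (\<exists>N\<le>d. satisfies_simple_ode K S N y)"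
    by (auto simp: simple_on_def)
next
  assume *: "smooth_on S y \<and> (\<exists>N\<le>d. satisfies_simple_ode K S N y)"
  then obtain N where N: "N \<le> d" "satisfies_simple_ode K S N y" by auto
  from N(2) have "simple_order K S y \<le> N" unfolding simple_order_def by (rule Least_le)
  with * N show "simple_on K S y \<and> simple_order K S y \<le> d" by (auto simp: simple_on_def)
qed

lemma satisfies_simple_odeE:
  assumes "satisfies_simple_ode K S N y"
  obtains p where "\<And>k. k \<le> N \<Longrightarrow> p k \<in> poly_over K" "p N \<noteq> 0"
    "\<And>x. x \<in> S \<Longrightarrow> (\<Sum>k\<le>N. poly (p k) (of_real x) * nderiv k y x) = 0"
  using assms unfolding satisfies_simple_ode_def by blast

lemma satisfies_simple_ode_subset:
  "satisfies_simple_ode K S N y \<Longrightarrow> T \<subseteq> S \<Longrightarrow> satisfies_simple_ode K T N y"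
  unfolding satisfies_simple_ode_def by blast

lemma satisfies_simple_ode_cong:
  assumes "open S" "\<And>x. x \<in> S \<Longrightarrow> y x = z x" "satisfies_simple_ode K S N y"
  shows "satisfies_simple_ode K S N z"
proof -
  have "nderiv k y x = nderiv k z x" if "x \<in> S" for k x
    using nderiv_cong_open[OF assms(1,2) that] .
  then show ?thesis using assms(3) by (simp add: satisfies_simple_ode_def cong: ball_cong)
qed

context constant_ring
begin

lemma rat_span_base:
  assumes "finite J" "j \<in> J"
  shows "rat_span K S J u (u j)"
  using assms
  by (intro rat_spanI[of 1 _ _ "\<lambda>i. if i = j then 1 else 0"]) 
     (auto intro!: poly_over_intros simp: if_distrib[of "\<lambda>p. poly p _"] if_distribR
       if_distrib[of "\<lambda>z. z * _"] cong: if_cong)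

lemma rat_span_zero: "rat_span K S J u (\<lambda>x. 0)"
  by (intro rat_spanI[of 1 _ _ "\<lambda>i. 0"]) (auto intro!: poly_over_intros)

lemma rat_span_add:
  assumes "rat_span K S J u y" "rat_span K S J u z"
  shows "rat_span K S J u (\<lambda>x. y x + z x)"
proof -
  obtain E c where y: "E \<in> poly_over K" "E \<noteq> 0" "\<And>j. j \<in> J \<Longrightarrow> c j \<in> poly_over K"
    "\<And>x. x \<in> S \<Longrightarrow> poly E (of_real x) * y x = (\<Sum>j\<in>J. poly (c j) (of_real x) * u j x)"
    using assms(1) by (rule rat_spanE) blast
  obtain F d where z: "F \<in> poly_over K" "F \<noteq> 0" "\<And>j. j \<in> J \<Longrightarrow> d j \<in> poly_over K"
    "\<And>x. x \<in> S \<Longrightarrow> poly F (of_real x) * z x = (\<Sum>j\<in>J. poly (d j) (of_real x) * u j x)"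
    using assms(2) by (rule rat_spanE) blast
  show ?thesis
  proof (rule rat_spanI[of "E * F" _ _ "\<lambda>j. F * c j + E * d j"])
    fix x assume x: "x \<in> S"
    have "poly (E * F) (of_real x) * (y x + z x)
        = poly F (of_real x) * (poly E (of_real x) * y x) + poly E (of_real x) * (poly F (of_real x) * z x)"
      by (simp add: algebra_simps)
    also have "\<dots> = (\<Sum>j\<in>J. poly (F * c j + E * d j) (of_real x) * u j x)"
      unfolding y(4)[OF x] z(4)[OF x] by (simp add: sum_distrib_left sum.distrib algebra_simps)
    finally show "poly (E * F) (of_real x) * (y x + z x)
        = (\<Sum>j\<in>J. poly (F * c j + E * d j) (of_real x) * u j x)" .
  qed (use y z in \<open>auto intro!: poly_over_intros\<close>)
qed

lemma rat_span_poly_mult: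
  assumes "p \<in> poly_over K" "rat_span K S J u y"
  shows "rat_span K S J u (\<lambda>x. poly p (of_real x) * y x)"
proof -
  obtain E c where y: "E \<in> poly_over K" "E \<noteq> 0" "\<And>j. j \<in> J \<Longrightarrow> c j \<in> poly_over K"
    "\<And>x. x \<in> S \<Longrightarrow> poly E (of_real x) * y x = (\<Sum>j\<in>J. poly (c j) (of_real x) * u j x)"
    using assms(2) by (rule rat_spanE) blast
  show ?thesis
  proof (rule rat_spanI[of E _ _ "\<lambda>j. p * c j"])
    fix x assume x: "x \<in> S"
    have "poly E (of_real x) * (poly p (of_real x) * y x)
        = poly p (of_real x) * (poly E (of_real x) * y x)"
      by (simp add: algebra_simps)
    then show "poly E (of_real x) * (poly p (of_real x) * y x)
        = (\<Sum>j\<in>J. poly (p * c j) (of_real x) * u j x)"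
      unfolding y(4)[OF x] by (simp add: sum_distrib_left algebra_simps)
  qed (use y assms(1) in \<open>auto intro!: poly_over_intros\<close>)
qed

lemma rat_span_cancel:
  assumes "p \<in> poly_over K" "p \<noteq> 0" "rat_span K S J u (\<lambda>x. poly p (of_real x) * y x)"
  shows "rat_span K S J u y"
proof -
  obtain E c where y: "E \<in> poly_over K" "E \<noteq> 0" "\<And>j. j \<in> J \<Longrightarrow> c j \<in> poly_over K"
    "\<And>x. x \<in> S \<Longrightarrow> poly E (of_real x) * (poly p (of_real x) * y x)
      = (\<Sum>j\<in>J. poly (c j) (of_real x) * u j x)"
    using assms(3) by (rule rat_spanE) blast
  show ?thesis
    by (rule rat_spanI[of "E * p" _ _ c]) (use y assms(1,2) in \<open>auto intro!: poly_over_intros simp: mult.assoc\<close>)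
qed

lemma rat_span_sum:
  assumes "\<And>i. i \<in> X \<Longrightarrow> rat_span K S J u (h i)"
  shows "rat_span K S J u (\<lambda>x. \<Sum>i\<in>X. h i x)"
  using assms by (induction X rule: infinite_finite_induct) (auto intro: rat_span_zero rat_span_add)

lemma rat_span_trans:
  assumes "rat_span K S J u y" "\<And>j. j \<in> J \<Longrightarrow> rat_span K S L v (u j)"
  shows "rat_span K S L v y"
proof -
  obtain E c where y: "E \<in> poly_over K" "E \<noteq> 0" "\<And>j. j \<in> J \<Longrightarrow> c j \<in> poly_over K"
    "\<And>x. x \<in> S \<Longrightarrow> poly E (of_real x) * y x = (\<Sum>j\<in>J. poly (c j) (of_real x) * u j x)"
    using assms(1) by (rule rat_spanE) blast
  have "rat_span K S L v (\<lambda>x. \<Sum>j\<in>J. poly (c j) (of_real x) * u j x)"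
    by (intro rat_span_sum rat_span_poly_mult y(3) assms(2))
  then have "rat_span K S L v (\<lambda>x. poly E (of_real x) * y x)"
    by (rule rat_span_cong) (simp add: y(4))
  then show ?thesis by (rule rat_span_cancel[OF y(1,2)])
qed

lemma rat_span_mult:
  assumes "rat_span K S J u y" "rat_span K S L v z"
  shows "rat_span K S (J \<times> L) (\<lambda>(i, j) x. u i x * v j x) (\<lambda>x. y x * z x)"
proof -
  obtain E c where y: "E \<in> poly_over K" "E \<noteq> 0" "\<And>j. j \<in> J \<Longrightarrow> c j \<in> poly_over K"
    "\<And>x. x \<in> S \<Longrightarrow> poly E (of_real x) * y x = (\<Sum>j\<in>J. poly (c j) (of_real x) * u j x)"
    using assms(1) by (rule rat_spanE) blast
  obtain F d where z: "F \<in> poly_over K" "F \<noteq> 0" "\<And>j. j \<in> L \<Longrightarrow> d j \<in> poly_over K"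
    "\<And>x. x \<in> S \<Longrightarrow> poly F (of_real x) * z x = (\<Sum>j\<in>L. poly (d j) (of_real x) * v j x)"
    using assms(2) by (rule rat_spanE) blast
  show ?thesis
  proof (rule rat_spanI[of "E * F" _ _ "\<lambda>(i, j). c i * d j"])
    fix x assume x: "x \<in> S"
    have "poly (E * F) (of_real x) * (y x * z x)
        = (poly E (of_real x) * y x) * (poly F (of_real x) * z x)"
      by (simp add: algebra_simps)
    also have "\<dots> = (\<Sum>(i, j)\<in>J \<times> L. (poly (c i) (of_real x) * u i x) * (poly (d j) (of_real x) * v j x))"
      unfolding y(4)[OF x] z(4)[OF x] by (simp add: sum_product sum.cartesian_product)
    also have "\<dots> = (\<Sum>j\<in>J \<times> L. poly (case j of (i, j) \<Rightarrow> c i * d j) (of_real x)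
        * (case j of (i, j) \<Rightarrow> \<lambda>x. u i x * v j x) x)"
      by (intro sum.cong) (auto simp: algebra_simps)
    finally show "poly (E * F) (of_real x) * (y x * z x) = (\<Sum>j\<in>J \<times> L.
        poly (case j of (i, j) \<Rightarrow> c i * d j) (of_real x) * (case j of (i, j) \<Rightarrow> \<lambda>x. u i x * v j x) x)" .
  qed (use y z in \<open>auto intro!: poly_over_intros\<close>)
qed

text \<open>
  Differentiating \<open>E y = \<Sum>j. c\<^sub>j u\<^sub>j\<close> expresses \<open>E y'\<close> by \<open>y\<close>, the \<open>u\<^sub>j\<close> and the \<open>u\<^sub>j'\<close>, all of which lie in
  the span.
\<close>
lemma rat_span_derivative:
  assumes "open S"
    and u: "\<And>j x. j \<in> J \<Longrightarrow> x \<in> S \<Longrightarrow> (u j has_vector_derivative u' j x) (at x)"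
      "\<And>j. j \<in> J \<Longrightarrow> rat_span K S J u (u' j)"
    and "finite J" and y: "rat_span K S J u y" "\<And>x. x \<in> S \<Longrightarrow> (y has_vector_derivative y' x) (at x)"
  shows "rat_span K S J u y'"
proof -
  obtain E c where E: "E \<in> poly_over K" "E \<noteq> 0" "\<And>j. j \<in> J \<Longrightarrow> c j \<in> poly_over K"
    "\<And>x. x \<in> S \<Longrightarrow> poly E (of_real x) * y x = (\<Sum>j\<in>J. poly (c j) (of_real x) * u j x)"
    using y(1) by (rule rat_spanE) blast
  have "rat_span K S J u (\<lambda>x. (\<Sum>j\<in>J. poly (c j) (of_real x) * u' j x + poly (pderiv (c j)) (of_real x) * u j x)
      + poly (- pderiv E) (of_real x) * y x)"
    using u(2) y(1) E assms(4)
    by (intro rat_span_add rat_span_sum rat_span_poly_mult) (auto intro!: poly_over_intros rat_span_base)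
  then have "rat_span K S J u (\<lambda>x. poly E (of_real x) * y' x)"
  proof (rule rat_span_cong)
    fix x assume x: "x \<in> S"
    have l: "((\<lambda>x. poly E (of_real x) * y x) has_vector_derivative
        poly E (of_real x) * y' x + poly (pderiv E) (of_real x) * y x) (at x)"
      by (intro has_vector_derivative_mult has_vector_derivative_poly y(2) x)
    have "((\<lambda>x. \<Sum>j\<in>J. poly (c j) (of_real x) * u j x) has_vector_derivative
        (\<Sum>j\<in>J. poly (c j) (of_real x) * u' j x + poly (pderiv (c j)) (of_real x) * u j x)) (at x)"
      by (intro has_vector_derivative_sum has_vector_derivative_mult has_vector_derivative_poly u(1) x)
    then have "((\<lambda>x. poly E (of_real x) * y x) has_vector_derivative
        (\<Sum>j\<in>J. poly (c j) (of_real x) * u' j x + poly (pderiv (c j)) (of_real x) * u j x)) (at x)"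
      by (rule has_vector_derivative_transform_within_open[OF _ assms(1) x]) (simp add: E(4))
    from vector_derivative_unique_at[OF this l]
    show "(\<Sum>j\<in>J. poly (c j) (of_real x) * u' j x + poly (pderiv (c j)) (of_real x) * u j x)
      + poly (- pderiv E) (of_real x) * y x = poly E (of_real x) * y' x"
      by simp
  qed
  then show ?thesis by (rule rat_span_cancel[OF E(1,2)])
qed

text \<open>
  The \<open>card J + 1\<close> derivatives of order at most \<open>card J\<close> have coefficient vectors of length \<open>card J\<close>, so
  some nontrivial polynomial combination of the vectors vanishes. Its last nonzero coefficient
  determines the order of the resulting equation.
\<close>
lemma satisfies_simple_ode_of_rat_span:
  assumes "finite J" "\<And>k. rat_span K S J u (nderiv k y)"
  shows "\<exists>N\<le>card J. satisfies_simple_ode K S N y"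
proof -
  let ?d = "card J"
  have "\<forall>k. \<exists>E c. E \<in> poly_over K \<and> E \<noteq> 0 \<and> (\<forall>j\<in>J. c j \<in> poly_over K) \<and>
     (\<forall>x\<in>S. poly E (of_real x) * nderiv k y x = (\<Sum>j\<in>J. poly (c j) (of_real x) * u j x))"
    using assms(2) unfolding rat_span_def by blast
  then obtain E c where E: "\<And>k. E k \<in> poly_over K" "\<And>k. E k \<noteq> 0"
      "\<And>k j. j \<in> J \<Longrightarrow> c k j \<in> poly_over K"
      "\<And>k x. x \<in> S \<Longrightarrow> poly (E k) (of_real x) * nderiv k y x
        = (\<Sum>j\<in>J. poly (c k j) (of_real x) * u j x)"
    unfolding choice_iff by blast
  have "\<exists>d. (\<forall>k\<in>{..?d}. d k \<in> poly_over K) \<and> (\<exists>k\<in>{..?d}. d k \<noteq> 0) \<and>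
      (\<forall>j\<in>J. (\<Sum>k\<in>{..?d}. c k j * d k) = 0)"
    by (rule homogeneous_system_nontrivial_solution)
      (use assms(1) E(3) in \<open>auto intro!: poly_over_0 poly_over_1 poly_over_diff poly_over_mult\<close>)
  then obtain d where d: "\<And>k. k \<le> ?d \<Longrightarrow> d k \<in> poly_over K" "\<exists>k\<le>?d. d k \<noteq> 0"
    "\<And>j. j \<in> J \<Longrightarrow> (\<Sum>k\<le>?d. c k j * d k) = 0" by auto
  define N where "N = Max {k. k \<le> ?d \<and> d k \<noteq> 0}"
  have fin: "finite {k. k \<le> ?d \<and> d k \<noteq> 0}" by simp
  have N: "N \<le> ?d" "d N \<noteq> 0"
    using Max_in[OF fin] d(2) unfolding N_def by auto
  have above: "d k = 0" if "k \<le> ?d" "k > N" for k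
    using Max_ge[OF fin, of k] that unfolding N_def by fastforce
  have "satisfies_simple_ode K S N y"
    unfolding satisfies_simple_ode_def
  proof (intro exI[of _ "\<lambda>k. d k * E k"] conjI allI impI ballI)
    fix x assume x: "x \<in> S"
    have "(\<Sum>k\<le>N. poly (d k * E k) (of_real x) * nderiv k y x)
        = (\<Sum>k\<le>?d. poly (d k * E k) (of_real x) * nderiv k y x)"
      using N above by (intro sum.mono_neutral_left) auto
    also have "\<dots> = (\<Sum>k\<le>?d. poly (d k) (of_real x) * (\<Sum>j\<in>J. poly (c k j) (of_real x) * u j x))"
      by (simp flip: E(4)[OF x] add: mult.assoc)
    also have "\<dots> = (\<Sum>j\<in>J. poly (\<Sum>k\<le>?d. c k j * d k) (of_real x) * u j x)"
      unfolding sum_distrib_left poly_sum sum_distrib_right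
      by (subst sum.swap) (simp add: algebra_simps)
    also have "\<dots> = 0" by (simp add: d(3))
    finally show "(\<Sum>k\<le>N. poly (d k * E k) (of_real x) * nderiv k y x) = 0" .
  qed (use N d E in \<open>auto intro!: poly_over_intros\<close>)
  with N show ?thesis by blast
qed

lemma rat_span_nderiv:
  assumes "open S" "finite J"
    and u: "\<And>j x. j \<in> J \<Longrightarrow> x \<in> S \<Longrightarrow> (u j has_vector_derivative u' j x) (at x)"
      "\<And>j. j \<in> J \<Longrightarrow> rat_span K S J u (u' j)"
    and y: "smooth_on S y" "rat_span K S J u y"
  shows "rat_span K S J u (nderiv k y)"
proof (induction k)
  case (Suc k)
  show ?case
    using assms(1) u assms(2) Suc.IH smooth_on_deriv[OF y(1)] by (rule rat_span_derivative)
qed (use y in simp)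

lemma simple_of_rat_span:
  assumes "open S" "finite J"
    and "\<And>j x. j \<in> J \<Longrightarrow> x \<in> S \<Longrightarrow> (u j has_vector_derivative u' j x) (at x)"
      "\<And>j. j \<in> J \<Longrightarrow> rat_span K S J u (u' j)"
    and "smooth_on S y" "rat_span K S J u y"
  shows "simple_on K S y \<and> simple_order K S y \<le> card J"
  unfolding simple_order_le_iff
  using assms(5) satisfies_simple_ode_of_rat_span[OF assms(2) rat_span_nderiv[OF assms]] by blast

section \<open>Algebraic operations and rational substitutions\<close>

text \<open>
  A relation between \<open>v 0\<close>, \<dots>, \<open>v n\<close> with \<open>q n \<noteq> 0\<close> can be solved for \<open>v n\<close>. The \<open>v k\<close> will be
  derivatives of a function, or their composites with a substitution.
\<close>
lemma rat_span_jet: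
  fixes n :: nat
  assumes q: "\<And>k. k \<le> n \<Longrightarrow> q k \<in> poly_over K" "q n \<noteq> 0"
      "\<And>x. x \<in> T \<Longrightarrow> (\<Sum>k\<le>n. poly (q k) (of_real x) * v k x) = 0"
    and "k \<le> n"
  shows "rat_span K T {..<n} v (v k)"
proof (cases "k < n")
  case True
  then show ?thesis by (intro rat_span_base) auto
next
  case False
  with \<open>k \<le> n\<close> have k: "k = n" by simp
  show ?thesis unfolding k
  proof (rule rat_spanI[of "q n" _ _ "\<lambda>k. - q k"])
    fix x assume "x \<in> T"
    then have "(\<Sum>k<n. poly (q k) (of_real x) * v k x) + poly (q n) (of_real x) * v n x = 0"
      using q(3) by (simp flip: lessThan_Suc_atMost)
    then show "poly (q n) (of_real x) * v n x = (\<Sum>k<n. poly (- q k) (of_real x) * v k x)"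
      by (simp add: add_eq_0_iff sum_negf)
  qed (use q in \<open>auto intro: poly_over_uminus\<close>)
qed

lemma rat_span_nderiv_self:
  assumes "open S" "smooth_on S f" "satisfies_simple_ode K S n f"
  shows "rat_span K S {..<n} (\<lambda>k. nderiv k f) (nderiv k f)"
proof -
  obtain p where p: "\<And>k. k \<le> n \<Longrightarrow> p k \<in> poly_over K" "p n \<noteq> 0"
    "\<And>x. x \<in> S \<Longrightarrow> (\<Sum>k\<le>n. poly (p k) (of_real x) * nderiv k f x) = 0"
    using assms(3) by (rule satisfies_simple_odeE) blast
  have jet: "rat_span K S {..<n} (\<lambda>k. nderiv k f) (nderiv k f)" if "k \<le> n" for k
    using p that by (rule rat_span_jet)
  show ?thesis
  proof (rule rat_span_nderiv[where u' = "\<lambda>k. nderiv (Suc k) f"])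
    show "rat_span K S {..<n} (\<lambda>k. nderiv k f) (nderiv (Suc k) f)" if "k \<in> {..<n}" for k
      using jet[of "Suc k"] that by simp
    show "rat_span K S {..<n} (\<lambda>k. nderiv k f) f"
      using jet[of 0] by simp
  qed (use assms(1,2) in \<open>auto intro: smooth_on_deriv\<close>)
qed

lemma simple_antiderivative:
  assumes "open S" "smooth_on S f" "satisfies_simple_ode K S n f"
    and F: "\<And>x. x \<in> S \<Longrightarrow> (F has_vector_derivative f x) (at x)"
  shows "simple_on K S F \<and> simple_order K S F \<le> n + 1"
proof -
  obtain p where p: "\<And>k. k \<le> n \<Longrightarrow> p k \<in> poly_over K" "p n \<noteq> 0"
    "\<And>x. x \<in> S \<Longrightarrow> (\<Sum>k\<le>n. poly (p k) (of_real x) * nderiv k f x) = 0"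
    using assms(3) by (rule satisfies_simple_odeE) blast
  have F': "nderiv (Suc k) F x = nderiv k f x" if "x \<in> S" for k x
    unfolding nderiv_vector_derivative[symmetric]
    using F assms(1) that by (intro nderiv_cong_open[of S]) (auto intro: vector_derivative_at)
  have "satisfies_simple_ode K S (Suc n) F"
    unfolding satisfies_simple_ode_def
  proof (intro exI[of _ "\<lambda>k. case k of 0 \<Rightarrow> 0 | Suc k \<Rightarrow> p k"] conjI allI impI ballI)
    fix x assume "x \<in> S"
    then show "(\<Sum>k\<le>Suc n. poly (case k of 0 \<Rightarrow> 0 | Suc k \<Rightarrow> p k) (of_real x) * nderiv k F x) = 0"
      using p(3) by (subst sum.atMost_Suc_shift) (simp add: F')
  qed (use p in \<open>auto split: nat.split intro: poly_over_0\<close>)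
  then show ?thesis
    using smooth_on_antiderivative[OF assms(1) F assms(2)] unfolding simple_order_le_iff by auto
qed

lemma simple_derivative:
  assumes "open S" "smooth_on S f" "satisfies_simple_ode K S n f"
  shows "simple_on K S (\<lambda>x. vector_derivative f (at x)) \<and>
    simple_order K S (\<lambda>x. vector_derivative f (at x)) \<le> n"
proof -
  have "simple_on K S (\<lambda>x. vector_derivative f (at x)) \<and>
    simple_order K S (\<lambda>x. vector_derivative f (at x)) \<le> card {..<n}"
  proof (rule simple_of_rat_span[where u = "\<lambda>k. nderiv k f" and u' = "\<lambda>k. nderiv (Suc k) f"])
    show "rat_span K S {..<n} (\<lambda>k. nderiv k f) (\<lambda>x. vector_derivative f (at x))"
      using rat_span_nderiv_self[OF assms, of "Suc 0"] by (simp add: nderiv_Suc)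
    show "smooth_on S (\<lambda>x. vector_derivative f (at x))"
      using assms(2) by (rule smooth_on_vector_derivative)
  qed (use assms(1,2) in \<open>auto intro: smooth_on_deriv rat_span_nderiv_self[OF assms]\<close>)
  then show ?thesis by simp
qed

lemma simple_add:
  assumes "open S" and f: "smooth_on S f" "satisfies_simple_ode K S n f"
    and g: "smooth_on S g" "satisfies_simple_ode K S m g"
  shows "simple_on K S (\<lambda>x. f x + g x) \<and> simple_order K S (\<lambda>x. f x + g x) \<le> n + m"
proof -
  let ?J = "{..<n} <+> {..<m}"
  let ?u = "case_sum (\<lambda>k. nderiv k f) (\<lambda>k. nderiv k g)"
  let ?u' = "case_sum (\<lambda>k. nderiv (Suc k) f) (\<lambda>k. nderiv (Suc k) g)"
  have F: "rat_span K S ?J ?u (nderiv k f)" for k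
  proof (rule rat_span_trans[OF rat_span_nderiv_self[OF assms(1) f]])
    fix j assume "j \<in> {..<n}"
    then show "rat_span K S ?J ?u (nderiv j f)"
      using rat_span_base[of ?J "Inl j" S ?u] by (simp add: InlI)
  qed
  have G: "rat_span K S ?J ?u (nderiv k g)" for k
  proof (rule rat_span_trans[OF rat_span_nderiv_self[OF assms(1) g]])
    fix j assume "j \<in> {..<m}"
    then show "rat_span K S ?J ?u (nderiv j g)"
      using rat_span_base[of ?J "Inr j" S ?u] by (simp add: InrI)
  qed
  have "simple_on K S (\<lambda>x. f x + g x) \<and> simple_order K S (\<lambda>x. f x + g x) \<le> card ?J"
  proof (rule simple_of_rat_span[where u = ?u and u' = ?u'])
    show "rat_span K S ?J ?u (\<lambda>x. f x + g x)"
      using rat_span_add[OF F[of 0] G[of 0]] by simp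
    show "smooth_on S (\<lambda>x. f x + g x)"
      using assms by (intro smooth_on_add)
  qed (use assms F G smooth_on_deriv in auto)
  then show ?thesis by (simp add: card_Plus)
qed

lemma simple_mult:
  assumes "open S" and f: "smooth_on S f" "satisfies_simple_ode K S n f"
    and g: "smooth_on S g" "satisfies_simple_ode K S m g"
  shows "simple_on K S (\<lambda>x. f x * g x) \<and> simple_order K S (\<lambda>x. f x * g x) \<le> n * m"
proof -
  let ?J = "{..<n} \<times> {..<m}"
  let ?u = "\<lambda>(i, j) x. nderiv i f x * nderiv j g x"
  let ?u' = "\<lambda>(i, j) x. nderiv i f x * nderiv (Suc j) g x + nderiv (Suc i) f x * nderiv j g x"
  have span: "rat_span K S ?J ?u (\<lambda>x. nderiv i f x * nderiv j g x)" for i j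
    by (intro rat_span_mult rat_span_nderiv_self assms)
  have "simple_on K S (\<lambda>x. f x * g x) \<and> simple_order K S (\<lambda>x. f x * g x) \<le> card ?J"
  proof (rule simple_of_rat_span[where u = ?u and u' = ?u'])
    show "rat_span K S ?J ?u (\<lambda>x. f x * g x)"
      using span[of 0 0] by simp
    show "smooth_on S (\<lambda>x. f x * g x)"
      using assms by (intro smooth_on_mult)
    show "rat_span K S ?J ?u (?u' j)" for j
      by (cases j) (auto intro!: rat_span_add span)
    show "(?u j has_vector_derivative ?u' j x) (at x)" if "x \<in> S" for j x
      using that smooth_on_deriv[OF f(1)] smooth_on_deriv[OF g(1)]
      by (cases j) (auto intro!: has_vector_derivative_mult)
  qed (use assms in auto)
  then show ?thesis by simp
qed

text \<open>
  Substituting \<open>a / b\<close> into a polynomial and clearing denominators by \<open>b\<^sup>M\<close>. One \<open>M\<close> must serve for all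
  coefficients of a differential equation, hence the bound instead of the exact degree.
\<close>
lemma homogenize_poly:
  assumes "a \<in> poly_over K" "b \<in> poly_over K" "p \<in> poly_over K" "degree p \<le> M"
  shows "\<exists>h\<in>poly_over K. \<forall>z. poly b z \<noteq> 0 \<longrightarrow>
    poly h z = poly b z ^ M * poly p (poly a z / poly b z)"
proof (intro bexI allI impI)
  let ?h = "\<Sum>i\<le>M. smult (coeff p i) (a ^ i * b ^ (M - i))"
  show "?h \<in> poly_over K"
    using assms by (intro poly_over_sum poly_over_smult poly_over_mult poly_over_power)
      (auto simp: poly_over_def)
  fix z assume b: "poly b z \<noteq> 0"
  have "poly p w = (\<Sum>i\<le>M. coeff p i * w ^ i)" for w
    unfolding poly_altdef using assms(4)
    by (intro sum.mono_neutral_left) (auto simp: coeff_eq_0)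
  then show "poly ?h z = poly b z ^ M * poly p (poly a z / poly b z)"
    using b by (auto simp: poly_sum sum_distrib_left power_diff power_divide intro!: sum.cong)
qed

text \<open>
  For nonconstant \<open>a / b\<close> the generators are \<open>f\<^sup>(\<^sup>k\<^sup>) \<circ> \<rho>\<close> with \<open>k < n\<close>. If \<open>a / b\<close> is constant, the
  leading coefficient of the equation may vanish after the substitution, but then \<open>f \<circ> \<rho>\<close> is constant
  and satisfies \<open>y' = 0\<close>, which is good enough unless \<open>n = 0\<close>, where \<open>f\<close> itself is zero.
\<close>
lemma simple_compose_rational:
  assumes "open S" and f: "smooth_on S f" "satisfies_simple_ode K S n f"
    and "a \<in> poly_over K" "b \<in> poly_over K" "b \<noteq> 0"
    and T: "open T" "\<And>x. x \<in> T \<Longrightarrow> poly b (of_real x) \<noteq> 0"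
    and \<rho>: "\<And>x. x \<in> T \<Longrightarrow> of_real (\<rho> x) = rat_fun a b x" "\<rho> ` T \<subseteq> S"
  shows "simple_on K T (\<lambda>x. f (\<rho> x)) \<and> simple_order K T (\<lambda>x. f (\<rho> x)) \<le> n"
proof -
  obtain p where p: "\<And>k. k \<le> n \<Longrightarrow> p k \<in> poly_over K" "p n \<noteq> 0"
    "\<And>x. x \<in> S \<Longrightarrow> (\<Sum>k\<le>n. poly (p k) (of_real x) * nderiv k f x) = 0"
    using f(2) by (rule satisfies_simple_odeE) blast
  have "smooth_on T (\<lambda>x. complex_of_real (\<rho> x))"
  proof (rule smooth_on_cong[OF T(1)])
    show "smooth_on T (rat_fun a b)" using T by (rule smooth_on_rat_fun)
  qed (simp add: \<rho>)
  with T(1) assms(1) have smooth: "smooth_on T (\<lambda>x. f (\<rho> x))"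
    using f(1) \<rho>(2) by (rule smooth_on_compose)
  show ?thesis
  proof (cases "\<exists>c. a = smult c b")
    case True
    then obtain c where c: "a = smult c b" by blast
    have \<rho>c: "\<rho> x = Re c" if "x \<in> T" for x
    proof -
      have "complex_of_real (\<rho> x) = c"
        using \<rho>(1)[OF that] T(2)[OF that] by (simp add: c rat_fun_def)
      then show ?thesis by (metis Re_complex_of_real)
    qed
    show ?thesis
    proof (cases "n = 0")
      case True
      have "continuous_on S f"
        using smooth_on_deriv[OF f(1), of _ 0]
        by (auto intro!: continuous_at_imp_continuous_on has_vector_derivative_continuous)
      then have "f x = 0" if "x \<in> S" for x
        using zero_of_poly_mult_zero[OF assms(1) _ p(2) _ that] p(3) by (simp add: True)
      then have "satisfies_simple_ode K T 0 (\<lambda>x. f (\<rho> x))"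
        unfolding satisfies_simple_ode_def using \<rho>(2)
        by (intro exI[of _ "\<lambda>_. 1"]) (auto intro: poly_over_1)
      then show ?thesis unfolding simple_order_le_iff using smooth by auto
    next
      case False
      have "nderiv 1 (\<lambda>x. f (\<rho> x)) x = nderiv 1 (\<lambda>x. f (Re c)) x" if "x \<in> T" for x
        by (rule nderiv_cong_open[OF T(1)]) (simp_all add: \<rho>c that)
      then have "nderiv (Suc 0) (\<lambda>x. f (\<rho> x)) x = 0" if "x \<in> T" for x
        using that by (simp add: nderiv_Suc)
      then have "satisfies_simple_ode K T 1 (\<lambda>x. f (\<rho> x))"
        unfolding satisfies_simple_ode_def
        by (intro exI[of _ "\<lambda>k. if k = 1 then 1 else 0"]) (auto intro!: poly_over_intros)
      moreover have "1 \<le> n" using False by simp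
      ultimately show ?thesis unfolding simple_order_le_iff using smooth by blast
    qed
  next
    case False
    define M where "M = Max ((\<lambda>k. degree (p k)) ` {..n})"
    have M: "degree (p k) \<le> M" if "k \<le> n" for k
      unfolding M_def using that by (intro Max_ge) auto
    define hom where "hom = (\<lambda>h k. \<forall>z. poly b z \<noteq> 0 \<longrightarrow>
      poly h z = poly b z ^ M * poly (p k) (poly a z / poly b z))"
    have "\<exists>h\<in>poly_over K. hom h k" if "k \<le> n" for k
      unfolding hom_def using homogenize_poly[OF assms(4,5) p(1)[OF that] M[OF that]] .
    then have "\<forall>k\<in>{..n}. \<exists>h. h \<in> poly_over K \<and> hom h k" by blast
    then obtain q where "\<forall>k\<in>{..n}. q k \<in> poly_over K \<and> hom (q k) k"
      using bchoice by metis
    then have q: "q k \<in> poly_over K" "poly b z \<noteq> 0 \<Longrightarrow>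
        poly (q k) z = poly b z ^ M * poly (p k) (poly a z / poly b z)" if "k \<le> n" for k z
      using that by (auto simp: hom_def)
    \<comment> \<open>Otherwise \<open>a / b\<close> would take all its values among the finitely many roots of \<open>p n\<close>. Each value is
      taken only finitely often, as \<open>a / b\<close> is not constant, but there are infinitely many points.\<close>
    have "q n \<noteq> 0"
    proof
      assume "q n = 0"
      then have root: "poly (p n) (poly a z / poly b z) = 0" if "poly b z \<noteq> 0" for z
        using q(2)[of n z] that by simp
      let ?R = "{w. poly (p n) w = 0}"
      let ?Z = "{z. poly b z = 0} \<union> (\<Union>w\<in>?R. {z. poly (a - smult w b) z = 0})"
      have "z \<in> ?Z" for z
      proof (cases "poly b z = 0")
        case False
        then have "poly a z / poly b z \<in> ?R" "z \<in> {z'. poly (a - smult (poly a z / poly b z) b) z' = 0}"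
          using root by auto
        then show ?thesis by blast
      qed simp
      then have "UNIV = ?Z" by blast
      have "a - smult w b \<noteq> 0" for w using False by auto
      then have "finite ?Z"
        using p(2) assms(6) by (intro finite_UnI finite_UN_I poly_roots_finite)
      with \<open>UNIV = ?Z\<close> have "finite (UNIV :: complex set)" by simp
      then show False by (simp add: infinite_UNIV_char_0)
    qed
    let ?u = "\<lambda>k x. nderiv k f (\<rho> x)"
    define A where "A = pderiv a * b - a * pderiv b"
    let ?w = "\<lambda>x. rat_fun A (b\<^sup>2) x"
    have w: "((\<lambda>x. complex_of_real (\<rho> x)) has_vector_derivative ?w x) (at x)" if "x \<in> T" for x
      using has_vector_derivative_rat_fun[OF T(2)[OF that], of a] unfolding A_def
      by (rule has_vector_derivative_transform_within_open[OF _ T(1) that]) (simp add: \<rho>)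
    have jet: "rat_span K T {..<n} ?u (?u k)" if "k \<le> n" for k
    proof (rule rat_span_jet[where q = q and n = n and v = ?u and k = k])
      show "q k \<in> poly_over K" if "k \<le> n" for k using q(1) that .
    next
      fix x assume x: "x \<in> T"
      have "(\<Sum>k\<le>n. poly (q k) (of_real x) * ?u k x)
          = poly b (of_real x) ^ M * (\<Sum>k\<le>n. poly (p k) (of_real (\<rho> x)) * ?u k x)"
        using q(2) T(2)[OF x] \<rho>(1)[OF x]
        by (simp add: sum_distrib_left rat_fun_def mult.assoc)
      also have "\<dots> = 0" using p(3)[of "\<rho> x"] \<rho>(2) x by auto
      finally show "(\<Sum>k\<le>n. poly (q k) (of_real x) * ?u k x) = 0" .
    qed (use \<open>q n \<noteq> 0\<close> that in auto)
    have "simple_on K T (\<lambda>x. f (\<rho> x)) \<and> simple_order K T (\<lambda>x. f (\<rho> x)) \<le> card {..<n}"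
    proof (rule simple_of_rat_span[where u = ?u and u' = "\<lambda>k x. ?w x * ?u (Suc k) x"])
      show "(?u k has_vector_derivative ?w x * ?u (Suc k) x) (at x)" if "x \<in> T" for k x
        using w[OF that] by (rule has_vector_derivative_compose_real)
          (use that \<rho>(2) in \<open>auto intro: smooth_on_deriv[OF f(1)]\<close>)
      show "rat_span K T {..<n} ?u (\<lambda>x. ?w x * ?u (Suc k) x)" if "k \<in> {..<n}" for k
      proof (rule rat_span_cancel)
        have "rat_span K T {..<n} ?u (\<lambda>x. poly A (of_real x) * ?u (Suc k) x)"
          using that assms(4,5) unfolding A_def
          by (intro rat_span_poly_mult jet poly_over_intros) auto
        then show "rat_span K T {..<n} ?u (\<lambda>x. poly (b\<^sup>2) (of_real x) * (?w x * ?u (Suc k) x))"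
          by (rule rat_span_cong) (use T(2) in \<open>simp add: rat_fun_def\<close>)
        show "b\<^sup>2 \<in> poly_over K" "b\<^sup>2 \<noteq> 0" using assms(5,6) by (auto intro: poly_over_power)
      qed
      show "rat_span K T {..<n} ?u (\<lambda>x. f (\<rho> x))" using jet[of 0] by simp
    qed (use T smooth in auto)
    then show ?thesis by simp
  qed
qed

section \<open>Extracting roots of the variable\<close>

text \<open>
  A nonzero \<open>P\<close> of degree \<open>e\<close> has a nonzero multiple in \<open>K[z\<^sup>q]\<close>, by counting: a cofactor \<open>H\<close> of degree at
  most \<open>e q\<close> has \<open>e q + 1\<close> coefficients, while at most \<open>e q\<close> of the exponents \<open>0, \<dots>, e q + e\<close> of the
  product are not multiples of \<open>q\<close> and have to disappear. The norm \<open>\<Prod>\<zeta>. P(\<zeta> z)\<close> over the roots of unity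
  would do as well, but its cofactor is not visibly defined over \<open>K\<close>.
\<close>
lemma exists_multiple_in_power:
  assumes P: "P \<in> poly_over K" "P \<noteq> 0" and "q > 0"
  obtains H Q where "H \<in> poly_over K" "Q \<in> poly_over K" "Q \<noteq> 0"
    "\<And>z. poly P z * poly H z = poly Q (z ^ q)"
proof -
  define e where "e = degree P"
  \<comment> \<open>The coefficient of \<open>z\<^sup>s\<close> in the product is linear in the coefficients of \<open>H\<close>, with matrix \<open>A\<close>.\<close>
  define A where "A = (\<lambda>s j. if j \<le> s then coeff P (s - j) else 0)"
  let ?L = "e * q + e"
  let ?I = "{s. s \<le> ?L \<and> \<not> q dvd s}" and ?M = "(\<lambda>i. i * q) ` {..e}"
  have "?I \<union> ?M \<subseteq> {..?L}"
    using assms(3) by (auto simp: trans_le_add1)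
  moreover have "card (?I \<union> ?M) = card ?I + card ?M"
    by (intro card_Un_disjoint) auto
  moreover have "card ?M = Suc e"
    using assms(3) by (subst card_image) (auto simp: inj_on_def)
  ultimately have "card ?I + Suc e \<le> Suc ?L"
    using card_mono[of "{..?L}" "?I \<union> ?M"] by simp
  then have "card ?I < card {..e * q}" by simp
  then have "\<exists>c. (\<forall>j\<in>{..e * q}. c j \<in> K) \<and> (\<exists>j\<in>{..e * q}. c j \<noteq> 0) \<and>
      (\<forall>s\<in>?I. (\<Sum>j\<in>{..e * q}. A s j * c j) = 0)"
    using P(1) zero_mem one_mem diff_mem mult_mem
    by (intro homogeneous_system_nontrivial_solution) (auto simp: A_def poly_over_def)
  then obtain c where c: "\<And>j. j \<le> e * q \<Longrightarrow> c j \<in> K" "\<exists>j\<le>e * q. c j \<noteq> 0"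
    "\<And>s. s \<le> ?L \<Longrightarrow> \<not> q dvd s \<Longrightarrow> (\<Sum>j\<le>e * q. A s j * c j) = 0"
    by auto
  define H where "H = (\<Sum>j\<le>e * q. monom (c j) j)"
  have coeff_H: "coeff H j = (if j \<le> e * q then c j else 0)" for j
    by (auto simp: H_def coeff_sum)
  have "H \<noteq> 0" using c(2) coeff_H by (metis coeff_0)
  have H: "H \<in> poly_over K"
    using c(1) by (auto simp: H_def intro!: poly_over_sum poly_over_monom)
  define C where "C = H * P"
  have "C \<noteq> 0" using P(2) \<open>H \<noteq> 0\<close> by (simp add: C_def)
  have C: "C \<in> poly_over K" unfolding C_def by (intro poly_over_mult H P(1))
  have "degree H \<le> e * q"
    by (rule degree_le) (simp add: coeff_H)
  then have "degree C \<le> ?L"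
    using degree_mult_le[of H P] by (simp add: C_def e_def)
  have dvd: "q dvd s" if "coeff C s \<noteq> 0" for s
  proof (rule ccontr)
    assume "\<not> q dvd s"
    have "s \<le> ?L" using le_degree[OF that] \<open>degree C \<le> ?L\<close> by simp
    have "coeff C s = (\<Sum>j\<le>s. coeff H j * coeff P (s - j))"
      by (simp add: C_def coeff_mult)
    also have "\<dots> = (\<Sum>j\<in>{..s} \<inter> {..e * q}. A s j * c j)"
      by (rule sum.mono_neutral_cong_right) (auto simp: A_def coeff_H)
    also have "\<dots> = (\<Sum>j\<le>e * q. A s j * c j)"
      by (rule sum.mono_neutral_left) (auto simp: A_def)
    also have "\<dots> = 0"
      using \<open>s \<le> ?L\<close> \<open>\<not> q dvd s\<close> by (rule c(3))
    finally show False using that by simp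
  qed
  define Q where "Q = (\<Sum>s\<le>degree C. monom (coeff C s) (s div q))"
  have Q: "poly Q (z ^ q) = poly C z" for z
  proof -
    have "poly Q (z ^ q) = (\<Sum>s\<le>degree C. coeff C s * z ^ (q * (s div q)))"
      by (simp add: Q_def poly_sum poly_monom power_mult)
    also have "\<dots> = (\<Sum>s\<le>degree C. coeff C s * z ^ s)"
    proof (rule sum.cong)
      fix s show "coeff C s * z ^ (q * (s div q)) = coeff C s * z ^ s"
        using dvd[of s] by (cases "coeff C s = 0") auto
    qed simp
    finally show ?thesis by (simp add: poly_altdef)
  qed
  show ?thesis
  proof (rule that[OF H])
    show "Q \<in> poly_over K"
      unfolding Q_def using C by (intro poly_over_sum poly_over_monom) (simp add: poly_over_def)
    show "Q \<noteq> 0"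
      using Q \<open>C \<noteq> 0\<close> poly_all_0_iff_0[of C] by auto
    show "poly P z * poly H z = poly Q (z ^ q)" for z
      by (simp add: Q C_def mult.commute)
  qed
qed

text \<open>
  Write \<open>\<tau> = x\<^sup>1\<^sup>/\<^sup>q\<close>. The generators \<open>\<tau>\<^sup>i h\<^sup>(\<^sup>k\<^sup>)(\<tau>)\<close> with \<open>i < q\<close> and \<open>k < n\<close> span every \<open>P(\<tau>) h\<^sup>(\<^sup>k\<^sup>)(\<tau>)\<close>:
  for \<open>k < n\<close> because \<open>\<tau>\<^sup>q = x\<close> reduces the exponents modulo \<open>q\<close>, and for \<open>k = n\<close> by the equation of \<open>h\<close>,
  multiplied so that its leading coefficient is a polynomial in \<open>\<tau>\<^sup>q\<close>. The derivatives of the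
  generators are of this form up to the factor \<open>\<tau>' / \<tau> = 1 / (q x)\<close>.
\<close>
lemma simple_compose_root:
  assumes "q > 0" and S: "open S" "S \<subseteq> {0<..}"
    and h: "smooth_on S h" "satisfies_simple_ode K S n h"
  defines "T \<equiv> {x. x > 0 \<and> x powr (1 / of_nat q) \<in> S}"
  shows "simple_on K T (\<lambda>x. h (x powr (1 / of_nat q))) \<and>
    simple_order K T (\<lambda>x. h (x powr (1 / of_nat q))) \<le> n * q"
proof -
  define \<tau> where "\<tau> = (\<lambda>x :: real. x powr (1 / of_nat q))"
  define w where "w = (\<lambda>x. complex_of_real (1 / of_nat q * x powr (1 / of_nat q - 1)))"
  have T: "\<tau> x \<in> S" "x > 0" if "x \<in> T" for x using that by (auto simp: T_def \<tau>_def)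
  have "continuous_on {0<..} \<tau>"
    unfolding \<tau>_def by (intro continuous_intros) auto
  then have "open ({0<..} \<inter> \<tau> -` S)"
    using S(1) by (intro continuous_open_preimage) auto
  also have "{0<..} \<inter> \<tau> -` S = T" by (auto simp: T_def \<tau>_def)
  finally have "open T" .
  have \<tau>q: "of_real (\<tau> x) ^ q = (of_real x :: complex)" if "x \<in> T" for x
  proof -
    have "\<tau> x ^ q = x"
      using T(2)[OF that] \<open>q > 0\<close> by (simp add: \<tau>_def powr_power)
    then show ?thesis by (simp flip: of_real_power)
  qed
  have w: "((\<lambda>x. complex_of_real (\<tau> x)) has_vector_derivative w x) (at x)" if "x \<in> T" for x
    unfolding \<tau>_def w_def using T(2)[OF that] by (rule has_vector_derivative_powr)
  have qxw: "of_nat q * of_real x * w x = of_real (\<tau> x)" if "x \<in> T" for x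
  proof -
    have "real q * x * (1 / of_nat q * x powr (1 / of_nat q - 1)) = \<tau> x"
      using T(2)[OF that] \<open>q > 0\<close> by (simp add: \<tau>_def powr_diff)
    from arg_cong[OF this, of complex_of_real] show ?thesis
      by (simp only: w_def of_real_mult of_real_of_nat_eq)
  qed
  have smooth: "smooth_on T (\<lambda>x. h (\<tau> x))"
  proof (rule smooth_on_compose[OF \<open>open T\<close> S(1) _ h(1)])
    show "smooth_on T (\<lambda>x. complex_of_real (\<tau> x))"
      unfolding \<tau>_def using \<open>open T\<close> T(2) by (intro smooth_on_powr) auto
  qed (use T in auto)
  obtain p where p: "\<And>k. k \<le> n \<Longrightarrow> p k \<in> poly_over K" "p n \<noteq> 0"
    "\<And>x. x \<in> S \<Longrightarrow> (\<Sum>k\<le>n. poly (p k) (of_real x) * nderiv k h x) = 0"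
    using h(2) by (rule satisfies_simple_odeE) blast
  obtain H Q where H: "H \<in> poly_over K" and Q: "Q \<in> poly_over K" "Q \<noteq> 0"
    "\<And>z. poly (p n) z * poly H z = poly Q (z ^ q)"
    using exists_multiple_in_power[OF p(1)[OF order_refl] p(2) \<open>q > 0\<close>] by blast
  let ?J = "{..<q} \<times> {..<n}"
  let ?u = "\<lambda>(i, k) x. of_real (\<tau> x) ^ i * nderiv k h (\<tau> x)"
  have below: "rat_span K T ?J ?u (\<lambda>x. poly P (of_real (\<tau> x)) * nderiv k h (\<tau> x))"
    if "P \<in> poly_over K" "k < n" for P k
  proof -
    have "rat_span K T ?J ?u (\<lambda>x. \<Sum>s\<le>degree P.
        poly (monom (coeff P s) (s div q)) (of_real x) * ?u (s mod q, k) x)"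
    proof (intro rat_span_sum rat_span_poly_mult)
      fix s
      show "monom (coeff P s) (s div q) \<in> poly_over K"
        using that(1) by (intro poly_over_monom) (simp add: poly_over_def)
      show "rat_span K T ?J ?u (?u (s mod q, k))"
        using that(2) \<open>q > 0\<close> by (intro rat_span_base) auto
    qed
    then show ?thesis
    proof (rule rat_span_cong)
      fix x assume x: "x \<in> T"
      have "poly (monom (coeff P s) (s div q)) (of_real x) * ?u (s mod q, k) x
          = coeff P s * of_real (\<tau> x) ^ s * nderiv k h (\<tau> x)" for s
      proof -
        have "of_real (\<tau> x) ^ s = (of_real (\<tau> x) ^ q) ^ (s div q) * (of_real (\<tau> x) ^ (s mod q) :: complex)"
          by (simp flip: power_mult power_add)
        then show ?thesis by (simp add: poly_monom \<tau>q[OF x])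
      qed
      then show "(\<Sum>s\<le>degree P. poly (monom (coeff P s) (s div q)) (of_real x) * ?u (s mod q, k) x)
          = poly P (of_real (\<tau> x)) * nderiv k h (\<tau> x)"
        by (simp add: poly_altdef sum_distrib_right)
    qed
  qed
  have top: "rat_span K T ?J ?u (\<lambda>x. poly P (of_real (\<tau> x)) * nderiv n h (\<tau> x))"
    if P: "P \<in> poly_over K" for P
  proof (rule rat_span_cancel[OF Q(1,2)])
    have "rat_span K T ?J ?u
        (\<lambda>x. \<Sum>k<n. poly (- (H * P * p k)) (of_real (\<tau> x)) * nderiv k h (\<tau> x))"
      using p(1) by (intro rat_span_sum below poly_over_uminus poly_over_mult H P) auto
    then show "rat_span K T ?J ?u
        (\<lambda>x. poly Q (of_real x) * (poly P (of_real (\<tau> x)) * nderiv n h (\<tau> x)))"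
    proof (rule rat_span_cong)
      fix x assume x: "x \<in> T"
      let ?t = "complex_of_real (\<tau> x)"
      have "(\<Sum>k<n. poly (p k) ?t * nderiv k h (\<tau> x)) + poly (p n) ?t * nderiv n h (\<tau> x) = 0"
        using p(3)[OF T(1)[OF x]] by (simp flip: lessThan_Suc_atMost)
      then have lead: "poly (p n) ?t * nderiv n h (\<tau> x) = - (\<Sum>k<n. poly (p k) ?t * nderiv k h (\<tau> x))"
        by (simp add: add_eq_0_iff)
      have "poly Q (of_real x) = poly (p n) ?t * poly H ?t"
        by (simp add: Q(3) \<tau>q[OF x])
      then have "poly Q (of_real x) * (poly P ?t * nderiv n h (\<tau> x))
          = poly H ?t * poly P ?t * (poly (p n) ?t * nderiv n h (\<tau> x))"
        by simp
      also have "\<dots> = (\<Sum>k<n. poly (- (H * P * p k)) ?t * nderiv k h (\<tau> x))"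
        unfolding lead by (simp add: sum_distrib_left sum_negf mult.assoc)
      finally show "(\<Sum>k<n. poly (- (H * P * p k)) ?t * nderiv k h (\<tau> x))
          = poly Q (of_real x) * (poly P ?t * nderiv n h (\<tau> x))" by simp
    qed
  qed
  have span: "rat_span K T ?J ?u (\<lambda>x. poly P (of_real (\<tau> x)) * nderiv k h (\<tau> x))"
    if "P \<in> poly_over K" "k \<le> n" for P k
    using below[OF that(1), of k] top[OF that(1)] that(2) by (cases "k = n") auto
  let ?u' = "\<lambda>(i, k) x. w x * (of_real (\<tau> x) ^ i * nderiv (Suc k) h (\<tau> x)
      + of_nat i * of_real (\<tau> x) ^ (i - 1) * nderiv k h (\<tau> x))"
  have "simple_on K T (\<lambda>x. h (\<tau> x)) \<and> simple_order K T (\<lambda>x. h (\<tau> x)) \<le> card ?J"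
  proof (rule simple_of_rat_span[where u = ?u and u' = ?u'])
    fix j :: "nat \<times> nat" and x assume x: "x \<in> T"
    obtain i k where j: "j = (i, k)" by (cases j)
    have "((\<lambda>t. poly (monom 1 i) (of_real t) * nderiv k h t) has_vector_derivative
        poly (monom 1 i) (of_real (\<tau> x)) * nderiv (Suc k) h (\<tau> x)
        + poly (pderiv (monom 1 i)) (of_real (\<tau> x)) * nderiv k h (\<tau> x)) (at (\<tau> x))"
      using smooth_on_deriv[OF h(1) T(1)[OF x]]
      by (intro has_vector_derivative_mult has_vector_derivative_poly)
    from has_vector_derivative_compose_real[OF w[OF x] this]
    show "(?u j has_vector_derivative ?u' j x) (at x)"
      by (simp add: j poly_monom pderiv_monom)
  next
    fix j assume "j \<in> ?J"
    then obtain i k where j: "j = (i, k)" and k: "k < n" by auto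
    show "rat_span K T ?J ?u (?u' j)"
    proof (rule rat_span_cancel)
      show "monom (of_nat q) 1 \<in> poly_over K" "monom (of_nat q :: complex) 1 \<noteq> 0"
        using \<open>q > 0\<close> by (auto intro: poly_over_monom of_nat_mem simp: monom_eq_0_iff)
      have "rat_span K T ?J ?u
          (\<lambda>x. poly (monom 1 (Suc i)) (of_real (\<tau> x)) * nderiv (Suc k) h (\<tau> x)
            + poly (monom (of_nat i) i) (of_real (\<tau> x)) * nderiv k h (\<tau> x))"
        using k by (intro rat_span_add span poly_over_monom of_nat_mem one_mem) auto
      then show "rat_span K T ?J ?u (\<lambda>x. poly (monom (of_nat q) 1) (of_real x) * ?u' j x)"
      proof (rule rat_span_cong)
        fix x assume x: "x \<in> T"
        let ?t = "complex_of_real (\<tau> x)"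
        have pow: "?t * (of_nat i * ?t ^ (i - 1)) = of_nat i * ?t ^ i"
          by (cases i) auto
        have "poly (monom (of_nat q) 1) (of_real x) * ?u' j x
            = of_nat q * of_real x * w x * (?t ^ i * nderiv (Suc k) h (\<tau> x)
              + of_nat i * ?t ^ (i - 1) * nderiv k h (\<tau> x))"
          by (simp add: j poly_monom)
        also have "\<dots> = ?t * ?t ^ i * nderiv (Suc k) h (\<tau> x)
            + (?t * (of_nat i * ?t ^ (i - 1))) * nderiv k h (\<tau> x)"
          unfolding qxw[OF x] by (simp add: algebra_simps)
        also have "\<dots> = poly (monom 1 (Suc i)) ?t * nderiv (Suc k) h (\<tau> x)
            + poly (monom (of_nat i) i) ?t * nderiv k h (\<tau> x)"
          unfolding pow by (simp add: poly_monom)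
        finally show "poly (monom 1 (Suc i)) ?t * nderiv (Suc k) h (\<tau> x)
            + poly (monom (of_nat i) i) ?t * nderiv k h (\<tau> x)
            = poly (monom (of_nat q) 1) (of_real x) * ?u' j x" by simp
      qed
    qed
  next
    show "rat_span K T ?J ?u (\<lambda>x. h (\<tau> x))"
      using span[of 1 0] by (simp add: poly_over_1)
  qed (use \<open>open T\<close> smooth in auto)
  then show ?thesis by (simp add: \<tau>_def mult.commute)
qed

end

section \<open>Rational powers\<close>

text \<open>
  With \<^const>\<open>nat\<close> cutting off negative numbers, one of the two monomials is \<open>1\<close>, and the quotient is the
  integer power \<open>x\<^sup>p\<close> for either sign of \<open>p\<close>.
\<close>
lemma rat_fun_monom_powr:
  assumes "x > 0"
  shows "rat_fun (monom 1 (nat p)) (monom 1 (nat (- p))) x = of_real (x powr of_int p)"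
  using assms by (auto simp: rat_fun_def poly_monom powr_int)

context constant_ring
begin

lemma simple_compose_rat_dom:
  assumes "open S" "smooth_on S f" "satisfies_simple_ode K S n f"
    and "a \<in> poly_over K" "b \<in> poly_over K" "b \<noteq> 0"
  shows "simple_on K (rat_dom a b S) (\<lambda>x. f (Re (rat_fun a b x))) \<and>
    simple_order K (rat_dom a b S) (\<lambda>x. f (Re (rat_fun a b x))) \<le> n"
proof -
  have dom: "poly b (of_real x) \<noteq> 0 \<and> rat_fun a b x \<in> of_real ` S" if "x \<in> rat_dom a b S" for x
    using that interior_subset unfolding rat_dom_def by blast
  show ?thesis
  proof (rule simple_compose_rational[OF assms])
    show "open (rat_dom a b S)" by (simp add: rat_dom_def)
    show "of_real (Re (rat_fun a b x)) = rat_fun a b x" if "x \<in> rat_dom a b S" for x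
      using dom[OF that] by auto
    show "(\<lambda>x. Re (rat_fun a b x)) ` rat_dom a b S \<subseteq> S"
      using dom by fastforce
  qed (use dom in blast)
qed

lemma simple_compose_rational_power:
  fixes p :: int and q :: nat
  assumes "open S" "smooth_on S f" "satisfies_simple_ode K S n f" and "q > 0"
  defines "T \<equiv> {x. x > 0 \<and> x powr (of_int p / of_nat q) \<in> S}"
  shows "simple_on K T (\<lambda>x. f (x powr (of_int p / of_nat q))) \<and>
    simple_order K T (\<lambda>x. f (x powr (of_int p / of_nat q))) \<le> n * q"
proof -
  let ?a = "monom 1 (nat p) :: complex poly" and ?b = "monom 1 (nat (- p)) :: complex poly"
  let ?h = "\<lambda>t. f (Re (rat_fun ?a ?b t))"
  let ?S = "{0<..} \<inter> rat_dom ?a ?b S"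
  have "?b \<noteq> 0" by (simp add: monom_eq_0_iff)
  then have "simple_on K (rat_dom ?a ?b S) ?h \<and> simple_order K (rat_dom ?a ?b S) ?h \<le> n"
    by (intro simple_compose_rat_dom assms(1-3) poly_over_monom one_mem)
  then obtain N where N: "N \<le> n" and h: "smooth_on (rat_dom ?a ?b S) ?h"
      "satisfies_simple_ode K (rat_dom ?a ?b S) N ?h"
    unfolding simple_order_le_iff by blast
  have real: "rat_fun ?a ?b x \<in> \<real>" for x
    by (simp add: rat_fun_def poly_monom)
  have dom: "t \<in> ?S \<longleftrightarrow> t powr of_int p \<in> S" if "t > 0" for t
    using that by (auto simp: rat_dom_real[OF assms(1) real] rat_fun_monom_powr poly_monom)
  have T: "T = {x. x > 0 \<and> x powr (1 / of_nat q) \<in> ?S}"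
  proof -
    have "x powr (1 / of_nat q) \<in> ?S \<longleftrightarrow> x powr (of_int p / of_nat q) \<in> S" if "x > 0" for x
      using dom[of "x powr (1 / of_nat q)"] that by (simp add: powr_powr)
    then show ?thesis unfolding T_def by blast
  qed
  have "open ?S" by (auto simp: rat_dom_def)
  have "simple_on K T (\<lambda>x. ?h (x powr (1 / of_nat q))) \<and>
      simple_order K T (\<lambda>x. ?h (x powr (1 / of_nat q))) \<le> N * q"
    unfolding T
    by (rule simple_compose_root[OF assms(4) \<open>open ?S\<close> _ smooth_on_subset[OF h(1)]
      satisfies_simple_ode_subset[OF h(2)]]) auto
  then obtain L where L: "L \<le> N * q" and g: "smooth_on T (\<lambda>x. ?h (x powr (1 / of_nat q)))"
      "satisfies_simple_ode K T L (\<lambda>x. ?h (x powr (1 / of_nat q)))"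
    unfolding simple_order_le_iff by blast
  have "open T"
  proof -
    have "continuous_on {0<..} (\<lambda>x :: real. x powr (of_int p / of_nat q))"
      by (intro continuous_intros) auto
    then have "open ({0<..} \<inter> (\<lambda>x. x powr (of_int p / of_nat q)) -` S)"
      using assms(1) by (intro continuous_open_preimage) auto
    also have "{0<..} \<inter> (\<lambda>x. x powr (of_int p / of_nat q)) -` S = T"
      by (auto simp: T_def)
    finally show ?thesis .
  qed
  have eq: "?h (x powr (1 / of_nat q)) = f (x powr (of_int p / of_nat q))" if "x \<in> T" for x
    using that by (simp add: T_def rat_fun_monom_powr powr_powr)
  have "L \<le> n * q"
    using L N by (meson le_trans mult_le_mono1)
  then show ?thesis
    unfolding simple_order_le_iff
    using smooth_on_cong[OF \<open>open T\<close> eq g(1)] satisfies_simple_ode_cong[OF \<open>open T\<close> eq g(2)] by blast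
qed

end

theorem theorem3:
  fixes K :: "complex set" and I :: "real set" and f g :: "real \<Rightarrow> complex" and n m :: nat
    and a b :: "complex poly"
  assumes K: "K = \<rat> \<or> K = \<real> \<or> K = UNIV"
    and I: "open I" "is_interval I" "I \<noteq> {}"
    and f: "simple_on K I f" "simple_order K I f = n"
    and g: "simple_on K I g" "simple_order K I g = m"
    and r: "a \<in> poly_over K" "b \<in> poly_over K" "b \<noteq> 0" "coprime a b"
  shows
    "(\<forall>F. (\<forall>x\<in>I. (F has_vector_derivative f x) (at x)) \<longrightarrow>
        simple_on K I F \<and> simple_order K I F \<le> n + 1) \<and>
     (simple_on K I (\<lambda>x. vector_derivative f (at x)) \<and>
        simple_order K I (\<lambda>x. vector_derivative f (at x)) \<le> n) \<and>
     (simple_on K I (\<lambda>x. f x + g x) \<and> simple_order K I (\<lambda>x. f x + g x) \<le> n + m) \<and>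
     (simple_on K I (\<lambda>x. f x * g x) \<and> simple_order K I (\<lambda>x. f x * g x) \<le> n * m) \<and>
     (simple_on K (rat_dom a b I) (\<lambda>x. f (Re (rat_fun a b x))) \<and>
        simple_order K (rat_dom a b I) (\<lambda>x. f (Re (rat_fun a b x))) \<le> n) \<and>
     (\<forall>(p::int) (q::nat). q > 0 \<longrightarrow>
        simple_on K {x. x > 0 \<and> x powr (of_int p / of_nat q) \<in> I}
          (\<lambda>x. f (x powr (of_int p / of_nat q))) \<and>
        simple_order K {x. x > 0 \<and> x powr (of_int p / of_nat q) \<in> I}
          (\<lambda>x. f (x powr (of_int p / of_nat q))) \<le> n * q)"
proof -
  interpret constant_ring K
    using K constant_ring_Rats constant_ring_Reals constant_ring_UNIV by blast
  have f': "smooth_on I f" "satisfies_simple_ode K I n f"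
    using f LeastI_ex unfolding simple_on_def simple_order_def by metis+
  have g': "smooth_on I g" "satisfies_simple_ode K I m g"
    using g LeastI_ex unfolding simple_on_def simple_order_def by metis+
  show ?thesis
    using simple_antiderivative[OF I(1) f'] simple_derivative[OF I(1) f']
      simple_add[OF I(1) f' g'] simple_mult[OF I(1) f' g']
      simple_compose_rat_dom[OF I(1) f' r(1-3)] simple_compose_rational_power[OF I(1) f']
    by blast
qed

end
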